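(* The category $\mathbf{mzMaps}$ of maximal Boolean z-maps and the category $\mathbf{dzBoole}$ of Boolean dz-algebras are equivalent.
   Context: Boolean algebras with $0=1$ are allowed. $\mathbf{2}=\{0,1\}$ is the two-element Boolean algebra; $\mathbf{Boole}(A,\mathbf 2)$ is the set of Boolean homomorphisms $A\to\mathbf 2$. $\mathbf{Caba}$ is the category of complete atomic Boolean algebras and complete Boolean homomorphisms; $\mathrm{At}(B)$ is the set of atoms of $B$. $\mathrm{CO}(X)$ is the set of clopen subsets of a space $X$. For a Boolean algebra $A$ and $a\in A$, put $s_A(a)=\{x\in \mathbf{Boole}(A,\mathbf 2)\mid x(a)=1\}$; the Stone space $\mathsf S(A)$ is $\mathbf{Boole}(A,\mathbf 2)$ with the topology having $\{s_A(a)\mid a\in A\}$ as a base. For $X\subseteq \mathbf{Boole}(A,\mathbf 2)$ put $s_A^X(a)=X\cap s_A(a)$. A Boolean z-algebra is a pair $(A,X)$, where $A$ is a Boolean algebra and $X\subseteq\mathbf{Boole}(A,\mathbf 2)$, such that for each $a\in A\setminus\{0\}$ there is $x\in X$ with $x(a)=1$. A Boolean dz-algebra is a Boolean z-algebra $(A,X)$ such that $s_A^X(A)=\mathrm{CO}(X)$, where $X$ carries the subspace topology from $\mathsf S(A)$. $\mathbf{dzBoole}$ is the category whose objects are all Boolean dz-algebras and whose morphisms $(A,X)\to(A',X')$ are all pairs $(\varphi,f)$ with $\varphi:A\to A'$ a Boolean homomorphism and $f:X'\to X$ a function such that $x'\circ\varphi=f(x')$ for every $x'\in X'$; composition is $(\varphi',f')\circ(\varphi,f)=(\varphi'\circ\varphi,f\circ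 f')$ and identities are $(id_A,id_X)$. For a Boolean homomorphism $\alpha:A\to B$ and $x\in\mathrm{At}(B)$, let $\alpha_x:A\to\mathbf 2$ be the Boolean homomorphism with $\alpha_x(a)=1\Leftrightarrow x\le\alpha(a)$; put $X_\alpha=\{\alpha_x\mid x\in\mathrm{At}(B)\}$. For a Boolean algebra $A$ and $B\in\mathbf{Caba}$, a Boolean monomorphism $\alpha:A\to B$ is a Boolean z-map if every atom of $B$ is a meet of some elements of $\alpha(A)$. It is a maximal Boolean z-map (mz-map) if moreover $\mathrm{CO}(X_\alpha)=s_A^{X_\alpha}(A)$, where $X_\alpha$ is a subspace of $\mathsf S(A)$. $\mathbf{mzMaps}$ is the category whose objects are all mz-maps and whose morphisms from $\alpha:A\to B$ to $\alpha':A'\to B'$ are all pairs $(\varphi,\sigma)$ with $\varphi:A\to A'$ a Boolean homomorphism, $\sigma:B\to B'$ a complete Boolean homomorphism and $\alpha'\circ\varphi=\sigma\circ\alpha$; composition is componentwise and identities are $(id_A,id_B)$. *)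

theory Defs
  imports "HOL-Analysis.Abstract_Topology" "HOL-Library.Equipollence" "HOL-Algebra.Complete_Lattice"
begin

section \<open>Categories\<close>

text \<open>
  Hom-sets are indexed by their source and target and need not be disjoint, so the arrow part of a
  functor and the composition take these objects as arguments: \<open>Cmp C a b c g f\<close> is the
  composite of \<open>f : a \<rightarrow> b\<close> and \<open>g : b \<rightarrow> c\<close>.
\<close>

record ('o, 'm) precategory =
  Obj :: "'o set"
  Mor :: "'o \<Rightarrow> 'o \<Rightarrow> 'm set"
  Ident :: "'o \<Rightarrow> 'm"
  Cmp :: "'o \<Rightarrow> 'o \<Rightarrow> 'o \<Rightarrow> 'm \<Rightarrow> 'm \<Rightarrow> 'm"

locale category =
  fixes C :: "('o, 'm) precategory"
  assumes Ident_in: "a \<in> Obj C \<Longrightarrow> Ident C a \<in> Mor C a a"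
    and Cmp_in: "\<lbrakk>a \<in> Obj C; b \<in> Obj C; c \<in> Obj C; f \<in> Mor C a b; g \<in> Mor C b c\<rbrakk>
      \<Longrightarrow> Cmp C a b c g f \<in> Mor C a c"
    and Cmp_Ident_right: "\<lbrakk>a \<in> Obj C; b \<in> Obj C; f \<in> Mor C a b\<rbrakk>
      \<Longrightarrow> Cmp C a a b f (Ident C a) = f"
    and Cmp_Ident_left: "\<lbrakk>a \<in> Obj C; b \<in> Obj C; f \<in> Mor C a b\<rbrakk>
      \<Longrightarrow> Cmp C a b b (Ident C b) f = f"
    and Cmp_assoc: "\<lbrakk>a \<in> Obj C; b \<in> Obj C; c \<in> Obj C; d \<in> Obj C;
        f \<in> Mor C a b; g \<in> Mor C b c; h \<in> Mor C c d\<rbrakk>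
      \<Longrightarrow> Cmp C a c d h (Cmp C a b c g f) = Cmp C a b d (Cmp C b c d h g) f"

definition iso_mor :: "('o, 'm) precategory \<Rightarrow> 'o \<Rightarrow> 'o \<Rightarrow> 'm \<Rightarrow> bool" where
  "iso_mor C a b f \<longleftrightarrow> f \<in> Mor C a b \<and>
     (\<exists>g \<in> Mor C b a. Cmp C a b a g f = Ident C a \<and> Cmp C b a b f g = Ident C b)"

definition is_functor :: "('o, 'm) precategory \<Rightarrow> ('p, 'n) precategory \<Rightarrow>
    ('o \<Rightarrow> 'p) \<Rightarrow> ('o \<Rightarrow> 'o \<Rightarrow> 'm \<Rightarrow> 'n) \<Rightarrow> bool" where
  "is_functor C D F\<^sub>0 F\<^sub>1 \<longleftrightarrow>
     (\<forall>a \<in> Obj C. F\<^sub>0 a \<in> Obj D) \<and>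
     (\<forall>a \<in> Obj C. \<forall>b \<in> Obj C. \<forall>f \<in> Mor C a b. F\<^sub>1 a b f \<in> Mor D (F\<^sub>0 a) (F\<^sub>0 b)) \<and>
     (\<forall>a \<in> Obj C. F\<^sub>1 a a (Ident C a) = Ident D (F\<^sub>0 a)) \<and>
     (\<forall>a \<in> Obj C. \<forall>b \<in> Obj C. \<forall>c \<in> Obj C. \<forall>f \<in> Mor C a b. \<forall>g \<in> Mor C b c.
        F\<^sub>1 a c (Cmp C a b c g f) = Cmp D (F\<^sub>0 a) (F\<^sub>0 b) (F\<^sub>0 c) (F\<^sub>1 b c g) (F\<^sub>1 a b f))"

definition natural_iso :: "('o, 'm) precategory \<Rightarrow> ('p, 'n) precategory \<Rightarrow>
    ('o \<Rightarrow> 'p) \<Rightarrow> ('o \<Rightarrow> 'o \<Rightarrow> 'm \<Rightarrow> 'n) \<Rightarrow> ('o \<Rightarrow> 'p) \<Rightarrow> ('o \<Rightarrow> 'o \<Rightarrow> 'm \<Rightarrow> 'n) \<Rightarrow>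
    ('o \<Rightarrow> 'n) \<Rightarrow> bool" where
  "natural_iso C D F\<^sub>0 F\<^sub>1 G\<^sub>0 G\<^sub>1 \<eta> \<longleftrightarrow>
     (\<forall>a \<in> Obj C. iso_mor D (F\<^sub>0 a) (G\<^sub>0 a) (\<eta> a)) \<and>
     (\<forall>a \<in> Obj C. \<forall>b \<in> Obj C. \<forall>f \<in> Mor C a b.
        Cmp D (F\<^sub>0 a) (F\<^sub>0 b) (G\<^sub>0 b) (\<eta> b) (F\<^sub>1 a b f) =
        Cmp D (F\<^sub>0 a) (G\<^sub>0 a) (G\<^sub>0 b) (G\<^sub>1 a b f) (\<eta> a))"

definition equivalent_categories :: "('o, 'm) precategory \<Rightarrow> ('p, 'n) precategory \<Rightarrow> bool" where
  "equivalent_categories C D \<longleftrightarrow> category C \<and> category D \<and>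
     (\<exists>F\<^sub>0 F\<^sub>1 G\<^sub>0 G\<^sub>1 \<eta> \<epsilon>.
        is_functor C D F\<^sub>0 F\<^sub>1 \<and> is_functor D C G\<^sub>0 G\<^sub>1 \<and>
        natural_iso C C (\<lambda>a. a) (\<lambda>a b f. f)
          (\<lambda>a. G\<^sub>0 (F\<^sub>0 a)) (\<lambda>a b f. G\<^sub>1 (F\<^sub>0 a) (F\<^sub>0 b) (F\<^sub>1 a b f)) \<eta> \<and>
        natural_iso D D (\<lambda>a. F\<^sub>0 (G\<^sub>0 a)) (\<lambda>a b f. F\<^sub>1 (G\<^sub>0 a) (G\<^sub>0 b) (G\<^sub>1 a b f))
          (\<lambda>a. a) (\<lambda>a b f. f) \<epsilon>)"

section \<open>Boolean algebras\<close>

text \<open>The degenerate algebra, with \<open>\<bottom> = \<top>\<close>, is not excluded.\<close>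

locale boolean_alg = bounded_lattice +
  assumes meet_join_distrib: "\<lbrakk>x \<in> carrier L; y \<in> carrier L; z \<in> carrier L\<rbrakk>
      \<Longrightarrow> x \<sqinter> (y \<squnion> z) = (x \<sqinter> y) \<squnion> (x \<sqinter> z)"
    and complement_exists: "x \<in> carrier L
      \<Longrightarrow> \<exists>y \<in> carrier L. x \<sqinter> y = \<bottom> \<and> x \<squnion> y = \<top>"

text \<open>
  Maps between carriers are taken extensional, so that equality of morphisms is equality
  on the carrier. Preservation of complements follows from the clauses listed.
\<close>

definition bool_hom :: "'a gorder \<Rightarrow> 'b gorder \<Rightarrow> ('a \<Rightarrow> 'b) set" where
  "bool_hom A B = {\<phi> \<in> carrier A \<rightarrow>\<^sub>E carrier B.
     meet_pres A B \<phi> \<and> join_pres A B \<phi> \<and> \<phi> \<bottom>\<^bsub>A\<^esub> = \<bottom>\<^bsub>B\<^esub> \<and> \<phi> \<top>\<^bsub>A\<^esub> = \<top>\<^bsub>B\<^esub>}"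

definition two :: "bool gorder" where
  "two = \<lparr>carrier = UNIV, eq = (=), le = (\<le>)\<rparr>"

abbreviation Boole2 :: "'a gorder \<Rightarrow> ('a \<Rightarrow> bool) set" where
  "Boole2 A \<equiv> bool_hom A two"

definition At :: "'b gorder \<Rightarrow> 'b set" where
  "At B = {x \<in> carrier B. x \<noteq> \<bottom>\<^bsub>B\<^esub> \<and>
     (\<forall>y \<in> carrier B. y \<sqsubseteq>\<^bsub>B\<^esub> x \<longrightarrow> y = \<bottom>\<^bsub>B\<^esub> \<or> y = x)}"

definition caba :: "'b gorder \<Rightarrow> bool" where
  "caba B \<longleftrightarrow> boolean_alg B \<and> complete_lattice B \<and>
     (\<forall>b \<in> carrier B. b \<noteq> \<bottom>\<^bsub>B\<^esub> \<longrightarrow> (\<exists>x \<in> At B. x \<sqsubseteq>\<^bsub>B\<^esub> b))"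

definition complete_bool_hom :: "'b gorder \<Rightarrow> 'c gorder \<Rightarrow> ('b \<Rightarrow> 'c) set" where
  "complete_bool_hom B B' = {\<sigma> \<in> bool_hom B B'. sup_pres B B' \<sigma> \<and> inf_pres B B' \<sigma>}"

section \<open>Stone spaces\<close>

definition stone_set :: "'a gorder \<Rightarrow> 'a \<Rightarrow> ('a \<Rightarrow> bool) set" where
  "stone_set A a = {x \<in> Boole2 A. x a}"

definition stone_space :: "'a gorder \<Rightarrow> ('a \<Rightarrow> bool) topology" where
  "stone_space A = topology (arbitrary union_of (\<lambda>T. T \<in> stone_set A ` carrier A))"

definition stone_set_on :: "'a gorder \<Rightarrow> ('a \<Rightarrow> bool) set \<Rightarrow> 'a \<Rightarrow> ('a \<Rightarrow> bool) set" where
  "stone_set_on A X a = X \<inter> stone_set A a"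

definition CO :: "'x topology \<Rightarrow> 'x set set" where
  "CO T = {V. openin T V \<and> closedin T V}"

section \<open>Boolean dz-algebras\<close>

definition z_algebra :: "'a gorder \<Rightarrow> ('a \<Rightarrow> bool) set \<Rightarrow> bool" where
  "z_algebra A X \<longleftrightarrow> boolean_alg A \<and> X \<subseteq> Boole2 A \<and>
     (\<forall>a \<in> carrier A - {\<bottom>\<^bsub>A\<^esub>}. \<exists>x \<in> X. x a)"

definition dz_algebra :: "'a gorder \<Rightarrow> ('a \<Rightarrow> bool) set \<Rightarrow> bool" where
  "dz_algebra A X \<longleftrightarrow> z_algebra A X \<and>
     stone_set_on A X ` carrier A = CO (subtopology (stone_space A) X)"

text \<open>
  The sets \<open>U\<close> here and \<open>U\<close>, \<open>V\<close> for \<open>mzMaps\<close> are the universes from which the carriers of the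
  algebras are taken: \<open>UNIV\<close> gives all algebras with carrier in the type at hand, and the case
  \<open>U = V\<close> of a family closed under subsets and (up to bijection) power sets is that of a single
  universe. Two are allowed because no type contains the power sets of all its subsets, whereas
  a dz-algebra \<open>(A, X)\<close> corresponds to an mz-map from \<open>A\<close> into the power set of \<open>X\<close>.
\<close>

definition dzBoole :: "'a set set \<Rightarrow>
    ('a gorder \<times> ('a \<Rightarrow> bool) set, ('a \<Rightarrow> 'a) \<times> (('a \<Rightarrow> bool) \<Rightarrow> ('a \<Rightarrow> bool))) precategory" where
  "dzBoole U = \<lparr>
     Obj = {(A, X). carrier A \<in> U \<and> dz_algebra A X},
     Mor = (\<lambda>(A, X) (A', X'). {(\<phi>, f). \<phi> \<in> bool_hom A A' \<and> f \<in> X' \<rightarrow>\<^sub>E X \<and>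
              (\<forall>x' \<in> X'. compose (carrier A) x' \<phi> = f x')}),
     Ident = (\<lambda>(A, X). (\<lambda>a \<in> carrier A. a, \<lambda>x \<in> X. x)),
     Cmp = (\<lambda>(A, X) (A', X') (A'', X'') (\<phi>', f') (\<phi>, f).
              (compose (carrier A) \<phi>' \<phi>, compose X'' f f'))\<rparr>"

section \<open>Maximal Boolean z-maps\<close>

definition atom_pt :: "'a gorder \<Rightarrow> 'b gorder \<Rightarrow> ('a \<Rightarrow> 'b) \<Rightarrow> 'b \<Rightarrow> ('a \<Rightarrow> bool)" where
  "atom_pt A B \<alpha> x = (\<lambda>a \<in> carrier A. x \<sqsubseteq>\<^bsub>B\<^esub> \<alpha> a)"

definition X_of :: "'a gorder \<Rightarrow> 'b gorder \<Rightarrow> ('a \<Rightarrow> 'b) \<Rightarrow> ('a \<Rightarrow> bool) set" where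
  "X_of A B \<alpha> = atom_pt A B \<alpha> ` At B"

definition z_map :: "'a gorder \<Rightarrow> 'b gorder \<Rightarrow> ('a \<Rightarrow> 'b) \<Rightarrow> bool" where
  "z_map A B \<alpha> \<longleftrightarrow> boolean_alg A \<and> caba B \<and> \<alpha> \<in> bool_hom A B \<and> inj_on \<alpha> (carrier A) \<and>
     (\<forall>x \<in> At B. \<exists>S \<subseteq> \<alpha> ` carrier A. x = \<Sqinter>\<^bsub>B\<^esub> S)"

definition mz_map :: "'a gorder \<Rightarrow> 'b gorder \<Rightarrow> ('a \<Rightarrow> 'b) \<Rightarrow> bool" where
  "mz_map A B \<alpha> \<longleftrightarrow> z_map A B \<alpha> \<and>
     CO (subtopology (stone_space A) (X_of A B \<alpha>)) = stone_set_on A (X_of A B \<alpha>) ` carrier A"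

definition mzMaps :: "'a set set \<Rightarrow> 'b set set \<Rightarrow>
    ('a gorder \<times> 'b gorder \<times> ('a \<Rightarrow> 'b), ('a \<Rightarrow> 'a) \<times> ('b \<Rightarrow> 'b)) precategory" where
  "mzMaps U V = \<lparr>
     Obj = {(A, B, \<alpha>). carrier A \<in> U \<and> carrier B \<in> V \<and> mz_map A B \<alpha>},
     Mor = (\<lambda>(A, B, \<alpha>) (A', B', \<alpha>'). {(\<phi>, \<sigma>). \<phi> \<in> bool_hom A A' \<and>
              \<sigma> \<in> complete_bool_hom B B' \<and>
              compose (carrier A) \<alpha>' \<phi> = compose (carrier A) \<sigma> \<alpha>}),
     Ident = (\<lambda>(A, B, \<alpha>). (\<lambda>a \<in> carrier A. a, \<lambda>b \<in> carrier B. b)),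
     Cmp = (\<lambda>(A, B, \<alpha>) (A', B', \<alpha>') (A'', B'', \<alpha>'') (\<phi>', \<sigma>') (\<phi>, \<sigma>).
              (compose (carrier A) \<phi>' \<phi>, compose (carrier B) \<sigma>' \<sigma>))\<rparr>"

end

theory Submission
  imports Defs
begin

text \<open>
  A complete atomic Boolean algebra is the power set of its atoms, and its complete homomorphisms
  are the preimage maps of functions between the atoms in the opposite direction. For a z-map
  \<open>\<alpha> : A \<rightarrow> B\<close> the map \<open>x \<mapsto> \<alpha>\<^sub>x\<close> is injective on atoms, so a morphism \<open>(\<phi>, \<sigma>)\<close> out of \<open>\<alpha>\<close> is
  determined by \<open>\<phi>\<close>, and a given \<open>\<phi>\<close> extends to such a morphism if and only if composition with
  \<open>\<phi>\<close> carries points of the target into \<open>X\<^sub>\<alpha>\<close>. This makes \<open>\<alpha> \<mapsto> (A, X\<^sub>\<alpha>)\<close> a fully faithful functor;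
  it is surjective on objects because the map \<open>a \<mapsto> s\<^sub>A\<^sup>X(a)\<close> into a copy of the power set of \<open>X\<close> has
  \<open>X\<close> itself as its set of points. The dz-condition on \<open>(A, X\<^sub>\<alpha>)\<close> is literally the maximality
  condition on \<open>\<alpha>\<close>, so no topology enters.
\<close>

section \<open>Equivalences from fully faithful functors\<close>

text \<open>Preimages of objects are chosen so that \<open>F\<^sub>0 (G\<^sub>0 d) = d\<close> holds
  strictly, and the bijections on hom-sets then supply the arrow part of the inverse functor.
  Equations between arrows of \<open>C\<close> are proved by applying \<open>F\<^sub>1\<close> to
  both sides.\<close>

lemma equivalent_categories_if_bij_on_homs:
  fixes C :: "('o, 'm) precategory" and D :: "('p, 'n) precategory"
  assumes C: "category C" and D: "category D" and F: "is_functor C D F\<^sub>0 F\<^sub>1"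
    and bij: "\<And>a b. \<lbrakk>a \<in> Obj C; b \<in> Obj C\<rbrakk>
      \<Longrightarrow> bij_betw (F\<^sub>1 a b) (Mor C a b) (Mor D (F\<^sub>0 a) (F\<^sub>0 b))"
    and surj: "\<And>d. d \<in> Obj D \<Longrightarrow> \<exists>a \<in> Obj C. F\<^sub>0 a = d"
  shows "equivalent_categories C D"
proof -
  interpret C: category C by (rule C)
  interpret D: category D by (rule D)
  from surj obtain G\<^sub>0 where G0: "\<And>d. d \<in> Obj D \<Longrightarrow> G\<^sub>0 d \<in> Obj C"
    and FG0: "\<And>d. d \<in> Obj D \<Longrightarrow> F\<^sub>0 (G\<^sub>0 d) = d"
    by metis
  have F0: "F\<^sub>0 a \<in> Obj D" if "a \<in> Obj C" for a
    using F that unfolding is_functor_def by blast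
  have F1: "F\<^sub>1 a b f \<in> Mor D (F\<^sub>0 a) (F\<^sub>0 b)"
    if "a \<in> Obj C" "b \<in> Obj C" "f \<in> Mor C a b" for a b f
    using F that unfolding is_functor_def by blast
  have F_Ident: "F\<^sub>1 a a (Ident C a) = Ident D (F\<^sub>0 a)" if "a \<in> Obj C" for a
    using F that unfolding is_functor_def by blast
  have F_Cmp: "F\<^sub>1 a c (Cmp C a b c g f) =
      Cmp D (F\<^sub>0 a) (F\<^sub>0 b) (F\<^sub>0 c) (F\<^sub>1 b c g) (F\<^sub>1 a b f)"
    if "a \<in> Obj C" "b \<in> Obj C" "c \<in> Obj C" "f \<in> Mor C a b" "g \<in> Mor C b c" for a b c f g
    using F that unfolding is_functor_def by blast
  \<comment> \<open>Hom-sets may overlap, so the inverse of \<open>F\<^sub>1\<close> is taken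
    separately for each pair of objects.\<close>
  define lift where "lift a b = inv_into (Mor C a b) (F\<^sub>1 a b)" for a b
  have lift: "lift a b h \<in> Mor C a b" "F\<^sub>1 a b (lift a b h) = h"
    if "a \<in> Obj C" "b \<in> Obj C" "h \<in> Mor D (F\<^sub>0 a) (F\<^sub>0 b)" for a b h
    using bij[OF that(1,2)] that(3) unfolding lift_def bij_betw_def
    by (metis inv_into_into, metis f_inv_into_f)
  have faithful: "f = g"
    if "a \<in> Obj C" "b \<in> Obj C" "f \<in> Mor C a b" "g \<in> Mor C a b" "F\<^sub>1 a b f = F\<^sub>1 a b g" for a b f g
    using bij[OF that(1,2)] that unfolding bij_betw_def inj_on_def by blast
  define G\<^sub>1 where "G\<^sub>1 d e = lift (G\<^sub>0 d) (G\<^sub>0 e)" for d e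
  have G1: "G\<^sub>1 d e h \<in> Mor C (G\<^sub>0 d) (G\<^sub>0 e)" and FG1: "F\<^sub>1 (G\<^sub>0 d) (G\<^sub>0 e) (G\<^sub>1 d e h) = h"
    if "d \<in> Obj D" "e \<in> Obj D" "h \<in> Mor D d e" for d e h
    using lift[OF G0 G0] that FG0 unfolding G\<^sub>1_def by simp_all
  have G: "is_functor D C G\<^sub>0 G\<^sub>1"
    unfolding is_functor_def
  proof (intro conjI ballI)
    fix d assume d: "d \<in> Obj D"
    show "G\<^sub>1 d d (Ident D d) = Ident C (G\<^sub>0 d)"
      by (rule faithful[OF G0[OF d] G0[OF d]])
        (simp_all add: d G0 G1 FG1 FG0 F_Ident D.Ident_in C.Ident_in)
  next
    fix d e k f g
    assume *: "d \<in> Obj D" "e \<in> Obj D" "k \<in> Obj D" "f \<in> Mor D d e" "g \<in> Mor D e k"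
    have gf: "Cmp D d e k g f \<in> Mor D d k" using * by (rule D.Cmp_in)
    show "G\<^sub>1 d k (Cmp D d e k g f) = Cmp C (G\<^sub>0 d) (G\<^sub>0 e) (G\<^sub>0 k) (G\<^sub>1 e k g) (G\<^sub>1 d e f)"
    proof (rule faithful[OF G0[OF *(1)] G0[OF *(3)]])
      show "Cmp C (G\<^sub>0 d) (G\<^sub>0 e) (G\<^sub>0 k) (G\<^sub>1 e k g) (G\<^sub>1 d e f) \<in> Mor C (G\<^sub>0 d) (G\<^sub>0 k)"
        using * by (intro C.Cmp_in) (simp_all add: G0 G1)
    qed (simp_all add: * gf G0 G1 FG1 FG0 F_Cmp)
  qed (simp_all add: G0 G1)
  \<comment> \<open>\<open>F\<^sub>0\<close> takes the same value at \<open>a\<close> and at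
    \<open>G\<^sub>0 (F\<^sub>0 a)\<close>, so the identity of \<open>F\<^sub>0 a\<close> lifts to
    an arrow between these two objects. Its lift in the other direction will be the inverse.\<close>
  define \<eta> where "\<eta> a = lift a (G\<^sub>0 (F\<^sub>0 a)) (Ident D (F\<^sub>0 a))" for a
  have \<eta>: "\<eta> a \<in> Mor C a (G\<^sub>0 (F\<^sub>0 a))" and F\<eta>: "F\<^sub>1 a (G\<^sub>0 (F\<^sub>0 a)) (\<eta> a) = Ident D (F\<^sub>0 a)"
    if "a \<in> Obj C" for a
    using lift[OF that G0[OF F0[OF that]]] D.Ident_in[OF F0[OF that]] FG0[OF F0[OF that]]
    unfolding \<eta>_def by simp_all
  have "natural_iso C C (\<lambda>a. a) (\<lambda>a b f. f)
      (\<lambda>a. G\<^sub>0 (F\<^sub>0 a)) (\<lambda>a b f. G\<^sub>1 (F\<^sub>0 a) (F\<^sub>0 b) (F\<^sub>1 a b f)) \<eta>"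
    unfolding natural_iso_def
  proof (intro conjI ballI)
    fix a assume a: "a \<in> Obj C"
    let ?b = "G\<^sub>0 (F\<^sub>0 a)"
    have b: "?b \<in> Obj C" and Fb: "F\<^sub>0 ?b = F\<^sub>0 a" using a by (simp_all add: G0 F0 FG0)
    have I: "Ident D (F\<^sub>0 a) \<in> Mor D (F\<^sub>0 a) (F\<^sub>0 a)" using a by (simp add: D.Ident_in F0)
    let ?g = "lift ?b a (Ident D (F\<^sub>0 a))"
    have g: "?g \<in> Mor C ?b a" "F\<^sub>1 ?b a ?g = Ident D (F\<^sub>0 a)"
      using lift[OF b a] I Fb by simp_all
    have "Cmp C a ?b a ?g (\<eta> a) = Ident C a"
      by (rule faithful[OF a a])
        (simp_all add: a b g \<eta> F\<eta> F_Cmp F_Ident C.Cmp_in C.Ident_in Fb D.Cmp_Ident_left F0 I)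
    moreover have "Cmp C ?b a ?b (\<eta> a) ?g = Ident C ?b"
      by (rule faithful[OF b b])
        (simp_all add: a b g \<eta> F\<eta> F_Cmp F_Ident C.Cmp_in C.Ident_in Fb D.Cmp_Ident_left F0 I)
    ultimately show "iso_mor C a ?b (\<eta> a)"
      unfolding iso_mor_def using \<eta>[OF a] g(1) by blast
  next
    fix a b f assume *: "a \<in> Obj C" "b \<in> Obj C" "f \<in> Mor C a b"
    let ?a = "G\<^sub>0 (F\<^sub>0 a)" and ?b = "G\<^sub>0 (F\<^sub>0 b)"
    have o: "?a \<in> Obj C" "?b \<in> Obj C" "F\<^sub>0 ?a = F\<^sub>0 a" "F\<^sub>0 ?b = F\<^sub>0 b"
      using * by (simp_all add: G0 F0 FG0)
    note Ff = F1[OF *]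
    note GFf = G1[OF F0[OF *(1)] F0[OF *(2)] Ff] FG1[OF F0[OF *(1)] F0[OF *(2)] Ff]
    show "Cmp C a b ?b (\<eta> b) f = Cmp C a ?a ?b (G\<^sub>1 (F\<^sub>0 a) (F\<^sub>0 b) (F\<^sub>1 a b f)) (\<eta> a)"
      by (rule faithful[OF *(1) o(2)])
        (simp_all add: * o GFf \<eta> F\<eta> F_Cmp C.Cmp_in D.Cmp_Ident_left D.Cmp_Ident_right F0 Ff)
  qed
  \<comment> \<open>Because \<open>F\<^sub>0 (G\<^sub>0 d) = d\<close> strictly, identities serve as
    the counit.\<close>
  moreover have "natural_iso D D (\<lambda>d. F\<^sub>0 (G\<^sub>0 d)) (\<lambda>d e h. F\<^sub>1 (G\<^sub>0 d) (G\<^sub>0 e) (G\<^sub>1 d e h))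
      (\<lambda>d. d) (\<lambda>d e h. h) (Ident D)"
    unfolding natural_iso_def iso_mor_def
    by (auto simp: FG0 FG1 D.Ident_in D.Cmp_Ident_left D.Cmp_Ident_right)
  ultimately show ?thesis
    unfolding equivalent_categories_def using C D F G by blast
qed

section \<open>Complete atomic Boolean algebras as power sets\<close>

text \<open>One interface for three cases: a complete atomic algebra over its atoms,
  \<open>two\<close> over a one-point set, and the algebra built over a set \<open>X\<close> of
  points. Facts about \<open>L\<close> become set identities through \<open>h\<close>. The clause on
  \<open>eq\<close> is there because a \<open>gorder\<close> carries an equality relation of its
  own.\<close>

locale powerset_rep =
  fixes L :: "'b gorder" (structure) and h :: "'b \<Rightarrow> 'x set" and S :: "'x set"
  assumes eq: "eq L = (=)"
    and bij: "bij_betw h (carrier L) (Pow S)"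
    and le: "\<lbrakk>x \<in> carrier L; y \<in> carrier L\<rbrakk> \<Longrightarrow> x \<sqsubseteq> y \<longleftrightarrow> h x \<subseteq> h y"
begin

lemma h_sub: "x \<in> carrier L \<Longrightarrow> h x \<subseteq> S"
  using bij unfolding bij_betw_def by blast

lemma h_inj: "\<lbrakk>x \<in> carrier L; y \<in> carrier L; h x = h y\<rbrakk> \<Longrightarrow> x = y"
  using bij unfolding bij_betw_def inj_on_def by blast

lemma h_surj: "Y \<subseteq> S \<Longrightarrow> \<exists>x \<in> carrier L. h x = Y"
  using bij unfolding bij_betw_def by (metis Pow_iff imageE)

lemma partial_order_L: "partial_order L"
  by unfold_locales (auto simp: eq le intro: h_inj)

lemma least_Upper:
  assumes "A \<subseteq> carrier L" "s \<in> carrier L" "h s = \<Union> (h ` A)"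
  shows "least L s (Upper L A)"
  using assms by (intro least_UpperI) (auto simp: le Upper_def subset_iff)

text \<open>Intersecting with \<open>S\<close> gives the right value for the empty family, whose
  bare intersection would be the whole type.\<close>

lemma greatest_Lower:
  assumes "A \<subseteq> carrier L" "s \<in> carrier L" "h s = S \<inter> \<Inter> (h ` A)"
  shows "greatest L s (Lower L A)"
  using assms h_sub by (intro greatest_LowerI) (auto simp: le Lower_def subset_iff)

lemma complete_lattice_L: "complete_lattice L"
proof -
  interpret partial_order L by (rule partial_order_L)
  show ?thesis
  proof
    fix A assume A: "A \<subseteq> carrier L"
    then have "\<Union> (h ` A) \<subseteq> S" using h_sub by blast
    then show "\<exists>s. least L s (Upper L A)" using h_surj least_Upper[OF A] by metis
    have "S \<inter> \<Inter> (h ` A) \<subseteq> S" by blast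
    then show "\<exists>s. greatest L s (Lower L A)" using h_surj greatest_Lower[OF A] by metis
  qed
qed

sublocale complete_lattice L by (rule complete_lattice_L)

lemma h_sup: "A \<subseteq> carrier L \<Longrightarrow> h (\<Squnion> A) = \<Union> (h ` A)"
proof -
  assume A: "A \<subseteq> carrier L"
  then have "\<Union> (h ` A) \<subseteq> S" using h_sub by blast
  then obtain s where "s \<in> carrier L" "h s = \<Union> (h ` A)" using h_surj by metis
  then show ?thesis using least_unique[OF least_Upper[OF A] sup_lub[OF A]] by metis
qed

lemma h_inf: "A \<subseteq> carrier L \<Longrightarrow> h (\<Sqinter> A) = S \<inter> \<Inter> (h ` A)"
proof -
  assume A: "A \<subseteq> carrier L"
  have "S \<inter> \<Inter> (h ` A) \<subseteq> S" by blast
  then obtain s where "s \<in> carrier L" "h s = S \<inter> \<Inter> (h ` A)" using h_surj by metis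
  then show ?thesis using greatest_unique[OF greatest_Lower[OF A] inf_glb[OF A]] by metis
qed

lemma h_join: "\<lbrakk>x \<in> carrier L; y \<in> carrier L\<rbrakk> \<Longrightarrow> h (x \<squnion> y) = h x \<union> h y"
  unfolding join_def by (subst h_sup) auto

lemma h_meet: "\<lbrakk>x \<in> carrier L; y \<in> carrier L\<rbrakk> \<Longrightarrow> h (x \<sqinter> y) = h x \<inter> h y"
  unfolding meet_def using h_sub by (subst h_inf) auto

lemma h_bottom: "h \<bottom> = {}"
proof -
  obtain z where "z \<in> carrier L" "h z = {}" using h_surj[of "{}"] by auto
  then show ?thesis using le[of \<bottom> z] by auto
qed

lemma h_top: "h \<top> = S"
proof -
  obtain z where "z \<in> carrier L" "h z = S" using h_surj[of S] by auto
  then show ?thesis using le[of z \<top>] h_sub[of \<top>] by auto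
qed

lemma lattice_L: "lattice L"
  by unfold_locales

lemma boolean_alg_L: "boolean_alg L"
proof
  fix x y z assume "x \<in> carrier L" "y \<in> carrier L" "z \<in> carrier L"
  then show "x \<sqinter> (y \<squnion> z) = (x \<sqinter> y) \<squnion> (x \<sqinter> z)"
    by (intro h_inj) (auto simp: h_meet h_join)
next
  fix x assume x: "x \<in> carrier L"
  obtain y where "y \<in> carrier L" "h y = S - h x" using h_surj[of "S - h x"] by auto
  then show "\<exists>y \<in> carrier L. x \<sqinter> y = \<bottom> \<and> x \<squnion> y = \<top>"
    using x h_sub[OF x] by (intro bexI[of _ y] conjI h_inj) (auto simp: h_meet h_join h_bottom h_top)
qed

text \<open>Each point \<open>s\<close> of \<open>h x\<close> is realised by an element below
  \<open>x\<close> with image \<open>{s}\<close>. This element is not bottom, so it equals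
  \<open>x\<close> when \<open>x\<close> is an atom.\<close>

lemma At_iff: "x \<in> At L \<longleftrightarrow> x \<in> carrier L \<and> (\<exists>s \<in> S. h x = {s})"
proof
  assume x: "x \<in> At L"
  then have xL: "x \<in> carrier L" and "h x \<noteq> {}"
    unfolding At_def using h_inj[of x \<bottom>] h_bottom by auto
  then obtain s where s: "s \<in> h x" by blast
  obtain y where y: "y \<in> carrier L" "h y = {s}" using h_surj[of "{s}"] h_sub[OF xL] s by auto
  have "y = x" using x xL y s h_bottom unfolding At_def by (auto simp: le)
  then show "x \<in> carrier L \<and> (\<exists>s \<in> S. h x = {s})" using xL y s h_sub[OF xL] by auto
next
  assume "x \<in> carrier L \<and> (\<exists>s \<in> S. h x = {s})"
  then obtain s where *: "x \<in> carrier L" "s \<in> S" "h x = {s}" by blast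
  show "x \<in> At L"
    unfolding At_def
  proof (intro CollectI conjI ballI impI)
    show "x \<noteq> \<bottom>" using * h_bottom by auto
    fix y assume y: "y \<in> carrier L" "y \<sqsubseteq> x"
    then have "h y = {} \<or> h y = {s}" using * by (auto simp: le)
    then show "y = \<bottom> \<or> y = x" using * y h_bottom h_inj by (metis bottom_closed)
  qed (use * in auto)
qed

lemma caba_L: "caba L"
  unfolding caba_def
proof (intro conjI ballI impI boolean_alg_L complete_lattice_L)
  fix b assume b: "b \<in> carrier L" "b \<noteq> \<bottom>"
  then have "h b \<noteq> {}" using h_inj[of b \<bottom>] h_bottom by auto
  then obtain s where s: "s \<in> h b" by blast
  obtain y where "y \<in> carrier L" "h y = {s}" using h_surj[of "{s}"] h_sub[OF b(1)] s by auto
  then show "\<exists>x \<in> At L. x \<sqsubseteq> b" using s b h_sub[OF b(1)] by (intro bexI[of _ y]) (auto simp: le At_iff)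
qed

text \<open>Since \<open>h\<close> is injective on the carrier, equations in \<open>L\<close> can be
  tested on images. This serves both to construct homomorphisms into \<open>L\<close> and to read
  off their values.\<close>

lemma bool_hom_iff:
  assumes "bounded_lattice A" "\<phi> \<in> carrier A \<rightarrow>\<^sub>E carrier L"
  shows "\<phi> \<in> bool_hom A L \<longleftrightarrow>
    (\<forall>a \<in> carrier A. \<forall>b \<in> carrier A. h (\<phi> (a \<sqinter>\<^bsub>A\<^esub> b)) = h (\<phi> a) \<inter> h (\<phi> b)) \<and>
    (\<forall>a \<in> carrier A. \<forall>b \<in> carrier A. h (\<phi> (a \<squnion>\<^bsub>A\<^esub> b)) = h (\<phi> a) \<union> h (\<phi> b)) \<and>
    h (\<phi> \<bottom>\<^bsub>A\<^esub>) = {} \<and> h (\<phi> \<top>\<^bsub>A\<^esub>) = S"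
proof -
  interpret A: bounded_lattice A by (rule assms(1))
  have c: "\<phi> a \<in> carrier L" if "a \<in> carrier A" for a using assms(2) that by auto
  have eq_iff: "x = y \<longleftrightarrow> h x = h y" if "x \<in> carrier L" "y \<in> carrier L" for x y
    using h_inj that by blast
  have "\<phi> (a \<sqinter>\<^bsub>A\<^esub> b) = \<phi> a \<sqinter> \<phi> b \<longleftrightarrow> h (\<phi> (a \<sqinter>\<^bsub>A\<^esub> b)) = h (\<phi> a) \<inter> h (\<phi> b)"
    and "\<phi> (a \<squnion>\<^bsub>A\<^esub> b) = \<phi> a \<squnion> \<phi> b \<longleftrightarrow> h (\<phi> (a \<squnion>\<^bsub>A\<^esub> b)) = h (\<phi> a) \<union> h (\<phi> b)"
    if "a \<in> carrier A" "b \<in> carrier A" for a b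
    using that by (simp_all add: eq_iff c h_meet h_join)
  moreover have "\<phi> \<bottom>\<^bsub>A\<^esub> = \<bottom> \<longleftrightarrow> h (\<phi> \<bottom>\<^bsub>A\<^esub>) = {}" "\<phi> \<top>\<^bsub>A\<^esub> = \<top> \<longleftrightarrow> h (\<phi> \<top>\<^bsub>A\<^esub>) = S"
    by (simp_all add: eq_iff c h_bottom h_top)
  ultimately show ?thesis
    using assms A.lattice_axioms lattice_L unfolding bool_hom_def meet_pres_def join_pres_def by auto
qed

end

section \<open>Representation of a complete atomic Boolean algebra by its atoms\<close>

text \<open>If \<open>c\<close> is a complement of \<open>y\<close>, then \<open>x\<close> is the
  join of \<open>x \<sqinter> y\<close> and \<open>x \<sqinter> c\<close>, and the second part
  vanishes by hypothesis. The criterion turns a failure of the order into a nonzero element, below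
  which an atom or a point can be found.\<close>

lemma (in boolean_alg) le_if_meets_bottom:
  assumes "x \<in> carrier L" "y \<in> carrier L"
    and "\<And>c. \<lbrakk>c \<in> carrier L; y \<sqinter> c = \<bottom>\<rbrakk> \<Longrightarrow> x \<sqinter> c = \<bottom>"
  shows "x \<sqsubseteq> y"
proof -
  obtain c where c: "c \<in> carrier L" "y \<sqinter> c = \<bottom>" "y \<squnion> c = \<top>"
    using complement_exists[OF assms(2)] by blast
  have "x = x \<sqinter> \<top>" using assms(1) by (metis le_iff_join top_closed top_higher)
  also have "\<dots> = (x \<sqinter> y) \<squnion> (x \<sqinter> c)" using c assms(1,2) by (metis meet_join_distrib)
  also have "\<dots> = (x \<sqinter> y) \<squnion> \<bottom>" using assms c by simp
  also have "\<dots> \<sqsubseteq> y" using assms(1,2) by (intro join_le) (auto intro: meet_right)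
  finally show ?thesis .
qed

text \<open>Atoms determine the order, since below every nonzero element there is one, and each set
  of atoms is recovered as the set of atoms below its join.\<close>

lemma powerset_rep_caba:
  assumes "caba B"
  shows "powerset_rep B (\<lambda>b. {x \<in> At B. x \<sqsubseteq>\<^bsub>B\<^esub> b}) (At B)"
proof -
  interpret boolean_alg B using assms unfolding caba_def by blast
  interpret cl: complete_lattice B using assms unfolding caba_def by blast
  have At_carrier: "x \<in> carrier B" "x \<noteq> \<bottom>\<^bsub>B\<^esub>" if "x \<in> At B" for x
    using that unfolding At_def by auto
  have At_below: "\<exists>x \<in> At B. x \<sqsubseteq>\<^bsub>B\<^esub> b" if "b \<in> carrier B" "b \<noteq> \<bottom>\<^bsub>B\<^esub>" for b
    using assms that unfolding caba_def by blast
  have le_bottom: "x = \<bottom>\<^bsub>B\<^esub>" if "x \<in> carrier B" "x \<sqsubseteq>\<^bsub>B\<^esub> \<bottom>\<^bsub>B\<^esub>" for x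
    using that by (metis bottom_closed bottom_lower le_antisym)
  have le: "b \<sqsubseteq>\<^bsub>B\<^esub> c \<longleftrightarrow> {x \<in> At B. x \<sqsubseteq>\<^bsub>B\<^esub> b} \<subseteq> {x \<in> At B. x \<sqsubseteq>\<^bsub>B\<^esub> c}"
    if bc: "b \<in> carrier B" "c \<in> carrier B" for b c
  proof
    assume "b \<sqsubseteq>\<^bsub>B\<^esub> c"
    then show "{x \<in> At B. x \<sqsubseteq>\<^bsub>B\<^esub> b} \<subseteq> {x \<in> At B. x \<sqsubseteq>\<^bsub>B\<^esub> c}"
      using bc At_carrier by (auto intro: le_trans)
  next
    assume sub: "{x \<in> At B. x \<sqsubseteq>\<^bsub>B\<^esub> b} \<subseteq> {x \<in> At B. x \<sqsubseteq>\<^bsub>B\<^esub> c}"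
    show "b \<sqsubseteq>\<^bsub>B\<^esub> c"
    proof (rule le_if_meets_bottom[OF bc])
      fix d assume d: "d \<in> carrier B" "c \<sqinter>\<^bsub>B\<^esub> d = \<bottom>\<^bsub>B\<^esub>"
      show "b \<sqinter>\<^bsub>B\<^esub> d = \<bottom>\<^bsub>B\<^esub>"
      proof (rule ccontr)
        assume "b \<sqinter>\<^bsub>B\<^esub> d \<noteq> \<bottom>\<^bsub>B\<^esub>"
        \<comment> \<open>Such an atom lies below \<open>b\<close>, hence below \<open>c\<close> by
          \<open>sub\<close>, and also below \<open>d\<close>. So it lies below
          \<open>c \<sqinter> d\<close>, which is bottom.\<close>
        then obtain x where x: "x \<in> At B" "x \<sqsubseteq>\<^bsub>B\<^esub> b \<sqinter>\<^bsub>B\<^esub> d"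
          using At_below bc d by (meson meet_closed)
        have xB: "x \<in> carrier B" using x At_carrier by blast
        have "x \<sqsubseteq>\<^bsub>B\<^esub> b" "x \<sqsubseteq>\<^bsub>B\<^esub> d"
          using x xB bc d by (meson le_trans meet_left meet_right meet_closed)+
        then have "x \<sqsubseteq>\<^bsub>B\<^esub> c \<sqinter>\<^bsub>B\<^esub> d" using sub x xB bc d by (intro meet_le) auto
        then show False using x d xB At_carrier le_bottom by metis
      qed
    qed
  qed
  have surj: "{x \<in> At B. x \<sqsubseteq>\<^bsub>B\<^esub> \<Squnion>\<^bsub>B\<^esub> Y} = Y" if Y: "Y \<subseteq> At B" for Y
  proof
    have YB: "Y \<subseteq> carrier B" using Y At_carrier by blast
    show "Y \<subseteq> {x \<in> At B. x \<sqsubseteq>\<^bsub>B\<^esub> \<Squnion>\<^bsub>B\<^esub> Y}" using Y cl.sup_upper[OF YB] by blast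
    show "{x \<in> At B. x \<sqsubseteq>\<^bsub>B\<^esub> \<Squnion>\<^bsub>B\<^esub> Y} \<subseteq> Y"
    proof (rule subsetI, rule ccontr)
      fix x assume x: "x \<in> {x \<in> At B. x \<sqsubseteq>\<^bsub>B\<^esub> \<Squnion>\<^bsub>B\<^esub> Y}" "x \<notin> Y"
      then have xB: "x \<in> carrier B" "x \<noteq> \<bottom>\<^bsub>B\<^esub>" using At_carrier by blast+
      \<comment> \<open>The complement of an atom \<open>x\<close> outside \<open>Y\<close> is an
        upper bound of \<open>Y\<close>, because distinct atoms are disjoint. If \<open>x\<close>
        were below the join of \<open>Y\<close>, it would be below its own complement.\<close>
      obtain c where c: "c \<in> carrier B" "x \<sqinter>\<^bsub>B\<^esub> c = \<bottom>\<^bsub>B\<^esub>" "x \<squnion>\<^bsub>B\<^esub> c = \<top>\<^bsub>B\<^esub>"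
        using complement_exists[OF xB(1)] by blast
      have "y \<sqsubseteq>\<^bsub>B\<^esub> c" if y: "y \<in> Y" for y
      proof -
        have yB: "y \<in> carrier B" using YB y by blast
        have "y \<sqinter>\<^bsub>B\<^esub> x = \<bottom>\<^bsub>B\<^esub>"
        proof (rule ccontr)
          assume "y \<sqinter>\<^bsub>B\<^esub> x \<noteq> \<bottom>\<^bsub>B\<^esub>"
          moreover have "y \<sqinter>\<^bsub>B\<^esub> x \<in> carrier B" "y \<sqinter>\<^bsub>B\<^esub> x \<sqsubseteq>\<^bsub>B\<^esub> y" "y \<sqinter>\<^bsub>B\<^esub> x \<sqsubseteq>\<^bsub>B\<^esub> x"
            using yB xB by (auto intro: meet_left meet_right)
          ultimately have "y \<sqinter>\<^bsub>B\<^esub> x = y" "y \<sqinter>\<^bsub>B\<^esub> x = x"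
            using y Y x unfolding At_def by blast+
          then show False using y x by simp
        qed
        moreover have "y = y \<sqinter>\<^bsub>B\<^esub> (x \<squnion>\<^bsub>B\<^esub> c)"
          using yB c(3) by (metis le_iff_join top_closed top_higher)
        ultimately have "y = \<bottom>\<^bsub>B\<^esub> \<squnion>\<^bsub>B\<^esub> (y \<sqinter>\<^bsub>B\<^esub> c)"
          using meet_join_distrib[OF yB xB(1) c(1)] by simp
        moreover have "\<bottom>\<^bsub>B\<^esub> \<squnion>\<^bsub>B\<^esub> (y \<sqinter>\<^bsub>B\<^esub> c) \<sqsubseteq>\<^bsub>B\<^esub> c"
          using yB c by (intro join_le) (auto intro: meet_right)
        ultimately show ?thesis by metis
      qed
      then have "\<Squnion>\<^bsub>B\<^esub> Y \<sqsubseteq>\<^bsub>B\<^esub> c" by (intro cl.sup_least YB c)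
      then have "x \<sqsubseteq>\<^bsub>B\<^esub> c" using x xB c cl.sup_closed[OF YB] by (blast intro: le_trans)
      then have "x = x \<sqinter>\<^bsub>B\<^esub> c" using xB c by (metis le_iff_join)
      then show False using c xB by simp
    qed
  qed
  show ?thesis
  proof
    show "eq B = (=)" by (rule eq_is_equal)
    show "bij_betw (\<lambda>b. {x \<in> At B. x \<sqsubseteq>\<^bsub>B\<^esub> b}) (carrier B) (Pow (At B))"
      unfolding bij_betw_def
    proof (intro conjI inj_onI)
      fix b c assume bc: "b \<in> carrier B" "c \<in> carrier B"
        "{x \<in> At B. x \<sqsubseteq>\<^bsub>B\<^esub> b} = {x \<in> At B. x \<sqsubseteq>\<^bsub>B\<^esub> c}"
      have "b \<sqsubseteq>\<^bsub>B\<^esub> c" "c \<sqsubseteq>\<^bsub>B\<^esub> b"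
        using le[OF bc(1,2)] le[OF bc(2,1)] bc(3) by simp_all
      then show "b = c" using bc le_antisym by blast
    next
      show "(\<lambda>b. {x \<in> At B. x \<sqsubseteq>\<^bsub>B\<^esub> b}) ` carrier B = Pow (At B)"
      proof (intro equalityI subsetI)
        fix Y assume "Y \<in> Pow (At B)"
        then have Y: "Y \<subseteq> At B" by blast
        then have "\<Squnion>\<^bsub>B\<^esub> Y \<in> carrier B" using At_carrier by (intro cl.sup_closed) blast
        with surj[OF Y] show "Y \<in> (\<lambda>b. {x \<in> At B. x \<sqsubseteq>\<^bsub>B\<^esub> b}) ` carrier B"
          by (intro image_eqI[of _ _ "\<Squnion>\<^bsub>B\<^esub> Y"]) simp_all
      qed auto
    qed
  qed (rule le)
qed

text \<open>Truth values are the subsets of a one-point set, so \<open>bool_hom_iff\<close> also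
  covers the points of a Boolean algebra.\<close>

lemma powerset_rep_two: "powerset_rep two (\<lambda>b. {u. b}) {()}"
  by unfold_locales (auto simp: two_def bij_betw_def inj_on_def Pow_def image_iff set_eq_iff)

section \<open>Homomorphisms\<close>

lemma Boole2_iff:
  assumes "boolean_alg A"
  shows "x \<in> Boole2 A \<longleftrightarrow> x \<in> extensional (carrier A) \<and>
    (\<forall>a \<in> carrier A. \<forall>b \<in> carrier A. x (a \<sqinter>\<^bsub>A\<^esub> b) \<longleftrightarrow> x a \<and> x b) \<and>
    (\<forall>a \<in> carrier A. \<forall>b \<in> carrier A. x (a \<squnion>\<^bsub>A\<^esub> b) \<longleftrightarrow> x a \<or> x b) \<and>
    \<not> x \<bottom>\<^bsub>A\<^esub> \<and> x \<top>\<^bsub>A\<^esub>"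
proof -
  interpret A: boolean_alg A by (rule assms)
  have "carrier two = UNIV" by (simp add: two_def)
  show ?thesis
  proof (cases "x \<in> extensional (carrier A)")
    case True
    then have "x \<in> carrier A \<rightarrow>\<^sub>E carrier two" by (simp add: \<open>carrier two = UNIV\<close> PiE_def)
    note * = powerset_rep.bool_hom_iff[OF powerset_rep_two A.bounded_lattice_axioms this]
    have sets: "({u::unit. p} = {u. q} \<inter> {u. r}) \<longleftrightarrow> (p \<longleftrightarrow> q \<and> r)"
      "({u::unit. p} = {u. q} \<union> {u. r}) \<longleftrightarrow> (p \<longleftrightarrow> q \<or> r)"
      "({u::unit. p} = {}) \<longleftrightarrow> \<not> p" "({u::unit. p} = {()}) \<longleftrightarrow> p" for p q r
      by (auto simp: set_eq_iff)
    show ?thesis unfolding * sets using True by blast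
  next
    case False
    then show ?thesis unfolding bool_hom_def by (auto simp: PiE_def)
  qed
qed

lemma bool_hom_funcset: "\<phi> \<in> bool_hom A B \<Longrightarrow> \<phi> \<in> carrier A \<rightarrow> carrier B"
  and bool_hom_extensional: "\<phi> \<in> bool_hom A B \<Longrightarrow> \<phi> \<in> extensional (carrier A)"
  unfolding bool_hom_def PiE_def by blast+

lemma bool_hom_Ident:
  assumes "boolean_alg A"
  shows "(\<lambda>a \<in> carrier A. a) \<in> bool_hom A A"
proof -
  interpret boolean_alg A by (rule assms)
  show ?thesis
    unfolding bool_hom_def meet_pres_def join_pres_def using lattice_axioms by auto
qed

lemma bool_hom_compose:
  assumes "boolean_alg A" "\<phi> \<in> bool_hom A B" "\<psi> \<in> bool_hom B C"
  shows "compose (carrier A) \<psi> \<phi> \<in> bool_hom A C"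
proof -
  interpret boolean_alg A by (rule assms)
  show ?thesis
    using assms unfolding bool_hom_def meet_pres_def join_pres_def
    by (auto simp: compose_def PiE_iff)
qed

lemma complete_bool_hom_Ident:
  assumes "caba B"
  shows "(\<lambda>b \<in> carrier B. b) \<in> complete_bool_hom B B"
proof -
  interpret boolean_alg B using assms unfolding caba_def by blast
  interpret cl: complete_lattice B using assms unfolding caba_def by blast
  have "(\<lambda>b \<in> carrier B. b) ` A = A" if "A \<subseteq> carrier B" for A using that by auto
  then show ?thesis
    unfolding complete_bool_hom_def sup_pres_def inf_pres_def
    using cl.complete_lattice_axioms bool_hom_Ident[OF boolean_alg_axioms] by auto
qed

lemma complete_bool_hom_compose:
  assumes "caba B" "\<sigma> \<in> complete_bool_hom B B'" "\<tau> \<in> complete_bool_hom B' B''"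
  shows "compose (carrier B) \<tau> \<sigma> \<in> complete_bool_hom B B''"
proof -
  interpret boolean_alg B using assms unfolding caba_def by blast
  interpret cl: complete_lattice B using assms unfolding caba_def by blast
  have im: "compose (carrier B) \<tau> \<sigma> ` A = \<tau> ` \<sigma> ` A" if "A \<subseteq> carrier B" for A
    using that by (auto simp: compose_def image_image subset_iff intro!: image_cong)
  have sub: "\<sigma> ` A \<subseteq> carrier B'" if "A \<subseteq> carrier B" for A
    using that assms(2) unfolding complete_bool_hom_def bool_hom_def by (auto simp: PiE_iff)
  have "compose (carrier B) \<tau> \<sigma> \<in> bool_hom B B''"
    using assms bool_hom_compose[OF boolean_alg_axioms] unfolding complete_bool_hom_def by blast
  then show ?thesis
    using assms(2,3) im sub unfolding complete_bool_hom_def sup_pres_def inf_pres_def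
    by (auto simp: compose_eq)
qed

section \<open>Duality between complete homomorphisms and maps of atoms\<close>

text \<open>The atoms of \<open>B\<close> join to the top and \<sigma> preserves this join, so
  \<open>y\<close> lies below \<sigma> of some atom \<open>x\<close>. Sending \<open>y\<close> to
  \<open>x\<close> is the map of atoms dual to \<sigma>.\<close>

lemma complete_bool_hom_atom:
  assumes "caba B" "caba B'" "\<sigma> \<in> complete_bool_hom B B'" "y \<in> At B'"
  shows "\<exists>x \<in> At B. \<forall>b \<in> carrier B. y \<sqsubseteq>\<^bsub>B'\<^esub> \<sigma> b \<longleftrightarrow> x \<sqsubseteq>\<^bsub>B\<^esub> b"
proof -
  interpret B: powerset_rep B "\<lambda>b. {x \<in> At B. x \<sqsubseteq>\<^bsub>B\<^esub> b}" "At B"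
    by (rule powerset_rep_caba[OF assms(1)])
  interpret B': powerset_rep B' "\<lambda>b. {x \<in> At B'. x \<sqsubseteq>\<^bsub>B'\<^esub> b}" "At B'"
    by (rule powerset_rep_caba[OF assms(2)])
  have At: "At B \<subseteq> carrier B" and xB: "\<And>x. x \<in> At B \<Longrightarrow> x \<in> carrier B" unfolding At_def by auto
  have \<sigma>: "\<sigma> b \<in> carrier B'" if "b \<in> carrier B" for b
    using assms(3) that unfolding complete_bool_hom_def bool_hom_def by auto
  have \<sigma>_meet: "\<sigma> (b \<sqinter>\<^bsub>B\<^esub> c) = \<sigma> b \<sqinter>\<^bsub>B'\<^esub> \<sigma> c" if "b \<in> carrier B" "c \<in> carrier B" for b c
    using assms(3) that unfolding complete_bool_hom_def bool_hom_def meet_pres_def by auto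
  have \<sigma>_bot: "\<sigma> \<bottom>\<^bsub>B\<^esub> = \<bottom>\<^bsub>B'\<^esub>" and \<sigma>_top: "\<sigma> \<top>\<^bsub>B\<^esub> = \<top>\<^bsub>B'\<^esub>"
    using assms(3) unfolding complete_bool_hom_def bool_hom_def by auto
  have \<sigma>_sup: "\<Squnion>\<^bsub>B'\<^esub> (\<sigma> ` At B) = \<sigma> (\<Squnion>\<^bsub>B\<^esub> (At B))"
    using assms(3) At unfolding complete_bool_hom_def sup_pres_def by auto
  have "\<Squnion>\<^bsub>B\<^esub> (At B) = \<top>\<^bsub>B\<^esub>"
    by (rule B.h_inj) (use At in \<open>auto simp: B.h_sup B.h_top xB\<close>)
  then have "\<Squnion>\<^bsub>B'\<^esub> (\<sigma> ` At B) = \<top>\<^bsub>B'\<^esub>"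
    using \<sigma>_sup \<sigma>_top by simp
  then have "y \<in> {x \<in> At B'. x \<sqsubseteq>\<^bsub>B'\<^esub> \<Squnion>\<^bsub>B'\<^esub> (\<sigma> ` At B)}"
    using assms(4) B'.h_top by simp
  moreover have \<sigma>_At: "\<sigma> ` At B \<subseteq> carrier B'" using \<sigma> xB by blast
  ultimately obtain x where x: "x \<in> At B" "y \<sqsubseteq>\<^bsub>B'\<^esub> \<sigma> x"
    using B'.h_sup[OF \<sigma>_At] by auto
  have "y \<sqsubseteq>\<^bsub>B'\<^esub> \<sigma> b \<longleftrightarrow> x \<sqsubseteq>\<^bsub>B\<^esub> b" if b: "b \<in> carrier B" for b
  proof -
    \<comment> \<open>As \<open>y\<close> is below \<open>\<sigma> x\<close>, the test on
      \<open>b\<close> may be moved to \<open>x \<sqinter> b\<close>, which is either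
      \<open>x\<close> or bottom because \<open>x\<close> is an atom.\<close>
    have eq: "y \<sqsubseteq>\<^bsub>B'\<^esub> \<sigma> (x \<sqinter>\<^bsub>B\<^esub> b) \<longleftrightarrow> y \<sqsubseteq>\<^bsub>B'\<^esub> \<sigma> b"
      using B'.h_meet[OF \<sigma>[OF xB[OF x(1)]] \<sigma>[OF b]] x b assms(4) by (auto simp: \<sigma>_meet xB)
    have c: "x \<sqinter>\<^bsub>B\<^esub> b \<in> carrier B" "x \<sqinter>\<^bsub>B\<^esub> b \<sqsubseteq>\<^bsub>B\<^esub> x"
      using b x(1) xB by (auto intro: B.meet_left)
    show ?thesis
    proof (cases "x \<sqsubseteq>\<^bsub>B\<^esub> b")
      case True
      then have "x \<sqinter>\<^bsub>B\<^esub> b = x" using B.lattice_L b x(1) xB by (metis lattice.le_iff_join)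
      then show ?thesis using eq x(2) True by simp
    next
      case False
      then have "x \<sqinter>\<^bsub>B\<^esub> b \<noteq> x" using B.lattice_L b x(1) xB by (metis lattice.le_iff_join)
      then have "x \<sqinter>\<^bsub>B\<^esub> b = \<bottom>\<^bsub>B\<^esub>" using x(1) c unfolding At_def by blast
      then show ?thesis using eq False B'.h_bottom assms(4) \<sigma>_bot by auto
    qed
  qed
  then show ?thesis using x(1) by blast
qed

text \<open>Under the two power set representations \<sigma> is the preimage map of
  \<open>g\<close>, and preimages commute with arbitrary unions and intersections.\<close>

lemma complete_bool_hom_of_atom_map:
  assumes "caba B" "caba B'" "g \<in> At B' \<rightarrow> At B"
  shows "\<exists>\<sigma> \<in> complete_bool_hom B B'. \<forall>y \<in> At B'. \<forall>b \<in> carrier B. y \<sqsubseteq>\<^bsub>B'\<^esub> \<sigma> b \<longleftrightarrow> g y \<sqsubseteq>\<^bsub>B\<^esub> b"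
proof -
  define h where "h b = {x \<in> At B. x \<sqsubseteq>\<^bsub>B\<^esub> b}" for b
  define h' where "h' b = {x \<in> At B'. x \<sqsubseteq>\<^bsub>B'\<^esub> b}" for b
  interpret B: powerset_rep B h "At B"
    unfolding h_def by (rule powerset_rep_caba[OF assms(1)])
  interpret B': powerset_rep B' h' "At B'"
    unfolding h'_def by (rule powerset_rep_caba[OF assms(2)])
  \<comment> \<open>Every set of atoms of \<open>B'\<close> is a value of \<open>h'\<close>, so
    \<open>inv_into\<close> picks the element whose atoms are exactly those that \<open>g\<close>
    sends below \<open>b\<close>.\<close>
  define \<sigma> where "\<sigma> = (\<lambda>b \<in> carrier B. inv_into (carrier B') h' {y \<in> At B'. g y \<in> h b})"
  have \<sigma>: "\<sigma> b \<in> carrier B'" "h' (\<sigma> b) = {y \<in> At B'. g y \<in> h b}" if "b \<in> carrier B" for b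
  proof -
    have "{y \<in> At B'. g y \<in> h b} \<in> h' ` carrier B'"
      using B'.bij unfolding bij_betw_def by auto
    then show "\<sigma> b \<in> carrier B'" "h' (\<sigma> b) = {y \<in> At B'. g y \<in> h b}"
      using that unfolding \<sigma>_def by (simp_all add: inv_into_into f_inv_into_f)
  qed
  have ext: "\<sigma> \<in> carrier B \<rightarrow>\<^sub>E carrier B'" using \<sigma> by (auto simp: \<sigma>_def)
  interpret boolean_alg B by (rule B.boolean_alg_L)
  have g: "g y \<in> At B" if "y \<in> At B'" for y using assms(3) that by blast
  have "\<sigma> \<in> bool_hom B B'"
    unfolding B'.bool_hom_iff[OF bounded_lattice_axioms ext]
    using g by (auto simp: \<sigma> B.h_meet B.h_join B.h_bottom B.h_top)
  moreover have "\<sigma> (\<Squnion>\<^bsub>B\<^esub> A) = \<Squnion>\<^bsub>B'\<^esub> (\<sigma> ` A)" "\<sigma> (\<Sqinter>\<^bsub>B\<^esub> A) = \<Sqinter>\<^bsub>B'\<^esub> (\<sigma> ` A)"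
    if A: "A \<subseteq> carrier B" for A
  proof -
    have sub: "\<sigma> ` A \<subseteq> carrier B'" using A \<sigma> by blast
    show "\<sigma> (\<Squnion>\<^bsub>B\<^esub> A) = \<Squnion>\<^bsub>B'\<^esub> (\<sigma> ` A)"
      by (rule B'.h_inj) (use A sub in \<open>auto simp: \<sigma> B.h_sup B'.h_sup subset_iff\<close>)
    show "\<sigma> (\<Sqinter>\<^bsub>B\<^esub> A) = \<Sqinter>\<^bsub>B'\<^esub> (\<sigma> ` A)"
      by (rule B'.h_inj) (use A sub g in \<open>auto simp: \<sigma> B.h_inf B'.h_inf subset_iff\<close>)
  qed
  ultimately have "\<sigma> \<in> complete_bool_hom B B'"
    unfolding complete_bool_hom_def sup_pres_def inf_pres_def
    using B.complete_lattice_L B'.complete_lattice_L by blast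
  moreover have "y \<sqsubseteq>\<^bsub>B'\<^esub> \<sigma> b \<longleftrightarrow> g y \<sqsubseteq>\<^bsub>B\<^esub> b" if "y \<in> At B'" "b \<in> carrier B" for y b
    using \<sigma>(2)[OF that(2)] that(1) g[OF that(1)] unfolding h_def h'_def by blast
  ultimately show ?thesis by blast
qed

lemma complete_bool_hom_eqI:
  assumes "caba B'" "\<sigma> \<in> complete_bool_hom B B'" "\<tau> \<in> complete_bool_hom B B'"
    and "\<And>y b. \<lbrakk>y \<in> At B'; b \<in> carrier B\<rbrakk> \<Longrightarrow> y \<sqsubseteq>\<^bsub>B'\<^esub> \<sigma> b \<longleftrightarrow> y \<sqsubseteq>\<^bsub>B'\<^esub> \<tau> b"
  shows "\<sigma> = \<tau>"
proof -
  interpret B': powerset_rep B' "\<lambda>b. {x \<in> At B'. x \<sqsubseteq>\<^bsub>B'\<^esub> b}" "At B'"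
    by (rule powerset_rep_caba[OF assms(1)])
  have ext: "\<sigma> \<in> carrier B \<rightarrow>\<^sub>E carrier B'" "\<tau> \<in> carrier B \<rightarrow>\<^sub>E carrier B'"
    using assms(2,3) unfolding complete_bool_hom_def bool_hom_def by auto
  show ?thesis
  proof (rule PiE_ext[OF ext])
    fix b assume b: "b \<in> carrier B"
    show "\<sigma> b = \<tau> b"
      by (rule B'.h_inj) (use ext b assms(4)[OF _ b] in auto)
  qed
qed

section \<open>From mz-maps to dz-algebras\<close>

text \<open>For an atom, lying below an element is membership in its set of atoms, and membership
  turns intersections and unions into conjunctions and disjunctions.\<close>

lemma atom_pt_in_Boole2:
  assumes "boolean_alg A" "caba B" "\<alpha> \<in> bool_hom A B" "x \<in> At B"
  shows "atom_pt A B \<alpha> x \<in> Boole2 A"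
proof -
  interpret A: boolean_alg A by (rule assms)
  define h where "h b = {x \<in> At B. x \<sqsubseteq>\<^bsub>B\<^esub> b}" for b
  interpret B: powerset_rep B h "At B"
    unfolding h_def by (rule powerset_rep_caba[OF assms(2)])
  have "\<alpha> \<in> carrier A \<rightarrow>\<^sub>E carrier B" using assms(3) unfolding bool_hom_def by blast
  note hom = iffD1[OF B.bool_hom_iff[OF A.bounded_lattice_axioms this] assms(3)]
  have "x \<sqsubseteq>\<^bsub>B\<^esub> b \<longleftrightarrow> x \<in> h b" for b using assms(4) unfolding h_def by blast
  then show ?thesis
    unfolding Boole2_iff[OF assms(1)] atom_pt_def using hom assms(4) by simp
qed

text \<open>Here the condition on meets enters. If \<open>x\<close> is the meet of \<open>S\<close>
  and \<open>y\<close> induces the same point, then \<open>y\<close> is below every member of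
  \<open>S\<close>, because \<open>x\<close> is, and so \<open>y\<close> is below \<open>x\<close>.
  The roles of the two atoms can be exchanged.\<close>

lemma z_map_atom_pt_inj:
  assumes "z_map A B \<alpha>"
  shows "inj_on (atom_pt A B \<alpha>) (At B)"
proof (rule inj_onI)
  interpret B: powerset_rep B "\<lambda>b. {x \<in> At B. x \<sqsubseteq>\<^bsub>B\<^esub> b}" "At B"
    using assms powerset_rep_caba unfolding z_map_def by blast
  have \<alpha>: "\<alpha> ` carrier A \<subseteq> carrier B"
    using assms unfolding z_map_def bool_hom_def by auto
  have le: "y \<sqsubseteq>\<^bsub>B\<^esub> x"
    if xy: "x \<in> At B" "y \<in> At B" "atom_pt A B \<alpha> x = atom_pt A B \<alpha> y" for x y
  proof -
    obtain S where S: "S \<subseteq> \<alpha> ` carrier A" "x = \<Sqinter>\<^bsub>B\<^esub> S"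
      using assms xy(1) unfolding z_map_def by blast
    have SB: "S \<subseteq> carrier B" using S \<alpha> by blast
    have yB: "y \<in> carrier B" using xy(2) unfolding At_def by blast
    have "y \<sqsubseteq>\<^bsub>B\<^esub> s" if s: "s \<in> S" for s
    proof -
      obtain a where a: "a \<in> carrier A" "s = \<alpha> a" using S s by blast
      have "x \<sqsubseteq>\<^bsub>B\<^esub> s" using S(2) B.inf_lower[OF SB s] by simp
      then show ?thesis using fun_cong[OF xy(3), of a] a by (simp add: atom_pt_def)
    qed
    then show ?thesis unfolding S(2) by (intro B.inf_greatest SB yB)
  qed
  fix x y assume "x \<in> At B" "y \<in> At B" "atom_pt A B \<alpha> x = atom_pt A B \<alpha> y"
  with le[of x y] le[of y x] show "x = y" unfolding At_def by auto
qed

text \<open>An injective \<alpha> sends a nonzero \<open>a\<close> to a nonzero element, and any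
  atom below \<open>\<alpha> a\<close> induces a point that is true at \<open>a\<close>.\<close>

lemma mz_map_imp_dz_algebra:
  assumes "mz_map A B \<alpha>"
  shows "dz_algebra A (X_of A B \<alpha>)"
proof -
  have z: "boolean_alg A" "caba B" "\<alpha> \<in> bool_hom A B" "inj_on \<alpha> (carrier A)"
    using assms unfolding mz_map_def z_map_def by blast+
  interpret A: boolean_alg A by (rule z)
  have \<alpha>: "\<alpha> a \<in> carrier B" if "a \<in> carrier A" for a using z(3) that unfolding bool_hom_def by auto
  have bot: "\<alpha> \<bottom>\<^bsub>A\<^esub> = \<bottom>\<^bsub>B\<^esub>" using z(3) unfolding bool_hom_def by auto
  have "\<exists>x \<in> X_of A B \<alpha>. x a" if a: "a \<in> carrier A - {\<bottom>\<^bsub>A\<^esub>}" for a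
  proof -
    have "\<alpha> a \<noteq> \<bottom>\<^bsub>B\<^esub>" using a bot z(4) unfolding inj_on_def by (metis A.bottom_closed DiffE insertCI)
    then obtain x where "x \<in> At B" "x \<sqsubseteq>\<^bsub>B\<^esub> \<alpha> a" using z(2) \<alpha> a unfolding caba_def by blast
    then show ?thesis using a unfolding X_of_def by (auto simp: atom_pt_def)
  qed
  moreover have "X_of A B \<alpha> \<subseteq> Boole2 A"
    unfolding X_of_def using atom_pt_in_Boole2[OF z(1-3)] by blast
  ultimately show ?thesis
    using assms z(1) unfolding dz_algebra_def z_algebra_def mz_map_def by simp
qed

text \<open>When \<open>x\<close> is the atom dual to \<open>y\<close> under \<sigma>, commutativity
  of the square says that precomposing the point of \<open>y\<close> with \<phi> gives the point of
  \<open>x\<close>. This links the maps of points with the maps of atoms.\<close>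

lemma compose_atom_pt:
  assumes "\<phi> \<in> bool_hom A A'" "\<alpha> \<in> bool_hom A B"
    and "compose (carrier A) \<alpha>' \<phi> = compose (carrier A) \<sigma> \<alpha>"
    and "\<forall>b \<in> carrier B. y \<sqsubseteq>\<^bsub>B'\<^esub> \<sigma> b \<longleftrightarrow> x \<sqsubseteq>\<^bsub>B\<^esub> b"
  shows "compose (carrier A) (atom_pt A' B' \<alpha>' y) \<phi> = atom_pt A B \<alpha> x"
proof
  fix a
  show "compose (carrier A) (atom_pt A' B' \<alpha>' y) \<phi> a = atom_pt A B \<alpha> x a"
  proof (cases "a \<in> carrier A")
    case True
    then have "\<phi> a \<in> carrier A'" "\<alpha> a \<in> carrier B"
      using assms(1,2) unfolding bool_hom_def by auto
    moreover have "\<alpha>' (\<phi> a) = \<sigma> (\<alpha> a)" using fun_cong[OF assms(3), of a] True by (simp add: compose_def)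
    ultimately show ?thesis using True assms(4) by (simp add: compose_def atom_pt_def)
  qed (simp add: compose_def atom_pt_def)
qed

section \<open>From dz-algebras to mz-maps\<close>

text \<open>Inclusion is transported along the bijection. This places a copy of the power set on a
  prescribed carrier, as membership in the universe \<open>V\<close> requires.\<close>

lemma ex_powerset_rep:
  assumes "Pow S \<approx> T"
  shows "\<exists>L h. carrier L = T \<and> powerset_rep L h S"
proof -
  obtain k where k: "bij_betw k (Pow S) T" using assms unfolding eqpoll_def by blast
  let ?h = "inv_into (Pow S) k"
  let ?L = "\<lparr>carrier = T, eq = (=), le = (\<lambda>s t. ?h s \<subseteq> ?h t)\<rparr>"
  have "powerset_rep ?L ?h S"
    by unfold_locales (simp_all add: bij_betw_inv_into[OF k])
  then show ?thesis by (metis partial_object.select_convs(1))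
qed

text \<open>The atoms of \<open>L\<close> are the elements with image \<open>{x}\<close>, and such
  an atom is below \<open>\<alpha> a\<close> iff \<open>x a\<close>, so it induces the point
  \<open>x\<close> itself. Injectivity comes from the separation property of
  \<open>X\<close>.\<close>

lemma dz_algebra_imp_mz_map:
  assumes "dz_algebra A X" "powerset_rep L h X" "\<alpha> \<in> carrier A \<rightarrow>\<^sub>E carrier L"
    and h\<alpha>: "\<And>a. a \<in> carrier A \<Longrightarrow> h (\<alpha> a) = {x \<in> X. x a}"
  shows "mz_map A L \<alpha>" and "X_of A L \<alpha> = X"
proof -
  have A: "boolean_alg A" and X: "X \<subseteq> Boole2 A"
    and sep: "\<And>a. \<lbrakk>a \<in> carrier A; a \<noteq> \<bottom>\<^bsub>A\<^esub>\<rbrakk> \<Longrightarrow> \<exists>x \<in> X. x a"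
    using assms(1) unfolding dz_algebra_def z_algebra_def by blast+
  interpret A: boolean_alg A by (rule A)
  interpret L: powerset_rep L h X by (rule assms(2))
  note pt = X[THEN subsetD, unfolded Boole2_iff[OF A]]
  have pt_meet: "x (a \<sqinter>\<^bsub>A\<^esub> b) \<longleftrightarrow> x a \<and> x b" and pt_join: "x (a \<squnion>\<^bsub>A\<^esub> b) \<longleftrightarrow> x a \<or> x b"
    if "x \<in> X" "a \<in> carrier A" "b \<in> carrier A" for x a b using pt that by blast+
  have pt_bottom: "\<not> x \<bottom>\<^bsub>A\<^esub>" and pt_top: "x \<top>\<^bsub>A\<^esub>" and pt_ext: "x \<in> extensional (carrier A)"
    if "x \<in> X" for x using pt that by blast+
  have \<alpha>_closed: "\<alpha> a \<in> carrier L" if "a \<in> carrier A" for a using assms(3) that by blast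
  have At_iff: "t \<in> At L \<longleftrightarrow> t \<in> carrier L \<and> (\<exists>x \<in> X. h t = {x})" for t by (rule L.At_iff)
  have atom_pt: "atom_pt A L \<alpha> t = x" if "t \<in> carrier L" "x \<in> X" "h t = {x}" for t x
  proof
    fix a
    show "atom_pt A L \<alpha> t a = x a"
    proof (cases "a \<in> carrier A")
      case True
      then show ?thesis using that by (simp add: atom_pt_def L.le \<alpha>_closed h\<alpha>)
    next
      case False
      then show ?thesis using pt_ext[OF that(2)] by (simp add: atom_pt_def extensional_def)
    qed
  qed
  show X_of: "X_of A L \<alpha> = X"
  proof (intro equalityI subsetI)
    fix x assume x: "x \<in> X"
    obtain t where t: "t \<in> carrier L" "h t = {x}" using L.h_surj[of "{x}"] x by auto
    then show "x \<in> X_of A L \<alpha>"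
      unfolding X_of_def using x atom_pt[OF t(1) x t(2)] At_iff by (metis image_eqI)
  qed (auto simp: X_of_def At_iff atom_pt)
  have hom: "\<alpha> \<in> bool_hom A L"
    unfolding L.bool_hom_iff[OF A.bounded_lattice_axioms assms(3)]
    by (auto simp: h\<alpha> pt_meet pt_join pt_bottom pt_top)
  \<comment> \<open>Separation is assumed only for nonzero elements. It extends to the order by
    applying it to \<open>a \<sqinter> c\<close> with \<open>c\<close> disjoint from
    \<open>b\<close>.\<close>
  have le_if: "a \<sqsubseteq>\<^bsub>A\<^esub> b"
    if ab: "a \<in> carrier A" "b \<in> carrier A" and le: "\<And>x. x \<in> X \<Longrightarrow> x a \<Longrightarrow> x b" for a b
  proof (rule A.le_if_meets_bottom[OF ab], rule ccontr)
    fix c assume c: "c \<in> carrier A" "b \<sqinter>\<^bsub>A\<^esub> c = \<bottom>\<^bsub>A\<^esub>" "a \<sqinter>\<^bsub>A\<^esub> c \<noteq> \<bottom>\<^bsub>A\<^esub>"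
    then obtain x where x: "x \<in> X" "x (a \<sqinter>\<^bsub>A\<^esub> c)" using sep[of "a \<sqinter>\<^bsub>A\<^esub> c"] ab by auto
    then have "x (b \<sqinter>\<^bsub>A\<^esub> c)" using ab c le pt_meet by blast
    then show False using c(2) pt_bottom[OF x(1)] by simp
  qed
  have inj: "inj_on \<alpha> (carrier A)"
  proof (rule inj_onI)
    fix a b assume ab: "a \<in> carrier A" "b \<in> carrier A" "\<alpha> a = \<alpha> b"
    then have "{x \<in> X. x a} = {x \<in> X. x b}" using h\<alpha>[OF ab(1)] h\<alpha>[OF ab(2)] ab(3) by simp
    then show "a = b" using le_if[OF ab(1,2)] le_if[OF ab(2,1)] ab A.le_antisym by blast
  qed
  have "\<exists>S \<subseteq> \<alpha> ` carrier A. t = \<Sqinter>\<^bsub>L\<^esub> S" if "t \<in> At L" for t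
  proof -
    obtain x where t: "t \<in> carrier L" "x \<in> X" "h t = {x}" using \<open>t \<in> At L\<close> At_iff by blast
    \<comment> \<open>The atom belonging to \<open>x\<close> will be the meet of all images of
      elements at which \<open>x\<close> is true.\<close>
    let ?S = "\<alpha> ` {a \<in> carrier A. x a}"
    have S: "?S \<subseteq> carrier L" using \<alpha>_closed by blast
    have "y = x" if y: "y \<in> X" "\<And>a. \<lbrakk>a \<in> carrier A; x a\<rbrakk> \<Longrightarrow> y a" for y
    proof
      fix a
      show "y a = x a"
      proof (cases "a \<in> carrier A")
        case True
        then obtain c where c: "c \<in> carrier A" "a \<sqinter>\<^bsub>A\<^esub> c = \<bottom>\<^bsub>A\<^esub>" "a \<squnion>\<^bsub>A\<^esub> c = \<top>\<^bsub>A\<^esub>"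
          using A.complement_exists by blast
        \<comment> \<open>A point takes opposite values on complements, so a point that is true
          wherever \<open>x\<close> is true must agree with \<open>x\<close> everywhere.\<close>
        have "z c \<longleftrightarrow> \<not> z a" if "z \<in> X" for z
          using pt_meet[OF that True c(1)] pt_join[OF that True c(1)] pt_bottom[OF that] pt_top[OF that]
          unfolding c(2,3) by blast
        then show ?thesis using y t(2) c(1) True by blast
      next
        case False
        then show ?thesis using pt_ext[OF t(2)] pt_ext[OF y(1)] by (simp add: extensional_def)
      qed
    qed
    then have "X \<inter> \<Inter> (h ` ?S) = {x}" using t(2) by (auto simp: h\<alpha>)
    then have "t = \<Sqinter>\<^bsub>L\<^esub> ?S"
      using S t by (intro L.h_inj) (simp_all add: L.h_inf)
    moreover have "?S \<subseteq> \<alpha> ` carrier A" by blast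
    ultimately show ?thesis by (intro exI[of _ ?S] conjI)
  qed
  then have "z_map A L \<alpha>" unfolding z_map_def using A L.caba_L hom inj by blast
  then show "mz_map A L \<alpha>"
    using assms(1) unfolding mz_map_def X_of dz_algebra_def by simp
qed

section \<open>The equivalence\<close>

lemma category_dzBoole: "category (dzBoole U)"
proof
  fix a assume "a \<in> Obj (dzBoole U)"
  then obtain A X where a: "a = (A, X)" "boolean_alg A" "X \<subseteq> Boole2 A"
    unfolding dzBoole_def dz_algebra_def z_algebra_def by auto
  \<comment> \<open>Points are extensional, so precomposition with the restricted identity returns
    the same function.\<close>
  have "compose (carrier A) x (\<lambda>a \<in> carrier A. a) = x" if "x \<in> X" for x
    using a(3) that unfolding bool_hom_def by (auto simp: PiE_iff intro: compose_Id)
  then show "Ident (dzBoole U) a \<in> Mor (dzBoole U) a a"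
    unfolding a(1) dzBoole_def using bool_hom_Ident[OF a(2)] by simp
next
  fix a b c f g
  assume *: "a \<in> Obj (dzBoole U)" "b \<in> Obj (dzBoole U)" "c \<in> Obj (dzBoole U)"
    "f \<in> Mor (dzBoole U) a b" "g \<in> Mor (dzBoole U) b c"
  obtain A X A' X' A'' X'' \<phi> p \<psi> q
    where e: "a = (A, X)" "b = (A', X')" "c = (A'', X'')" "f = (\<phi>, p)" "g = (\<psi>, q)"
    by (metis surj_pair)
  have A: "boolean_alg A" using *(1) unfolding e dzBoole_def dz_algebra_def z_algebra_def by auto
  have f: "\<phi> \<in> bool_hom A A'" "p \<in> X' \<rightarrow>\<^sub>E X" "\<And>x. x \<in> X' \<Longrightarrow> compose (carrier A) x \<phi> = p x"
    using *(4) unfolding e dzBoole_def by auto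
  have g: "\<psi> \<in> bool_hom A' A''" "q \<in> X'' \<rightarrow>\<^sub>E X'" "\<And>x. x \<in> X'' \<Longrightarrow> compose (carrier A') x \<psi> = q x"
    using *(5) unfolding e dzBoole_def by auto
  have "\<phi> \<in> carrier A \<rightarrow> carrier A'" using f(1) unfolding bool_hom_def by auto
  then have "compose (carrier A) x (compose (carrier A) \<psi> \<phi>) = p (q x)" if "x \<in> X''" for x
    using that f(3)[of "q x"] g(2,3) compose_assoc by (metis PiE_mem)
  moreover have "compose X'' p q \<in> X'' \<rightarrow>\<^sub>E X" using f(2) g(2) by (auto simp: compose_def)
  ultimately show "Cmp (dzBoole U) a b c g f \<in> Mor (dzBoole U) a c"
    unfolding e dzBoole_def using bool_hom_compose[OF A f(1) g(1)] by (simp add: compose_eq)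
next
  fix a b f
  assume *: "a \<in> Obj (dzBoole U)" "b \<in> Obj (dzBoole U)" "f \<in> Mor (dzBoole U) a b"
  obtain A X A' X' \<phi> p where e: "a = (A, X)" "b = (A', X')" "f = (\<phi>, p)" by (metis surj_pair)
  have "\<phi> \<in> bool_hom A A'" and p: "p \<in> X' \<rightarrow> X" "p \<in> extensional X'"
    using *(3) unfolding e dzBoole_def PiE_def by auto
  note \<phi> = bool_hom_funcset[OF this(1)] bool_hom_extensional[OF this(1)]
  show "Cmp (dzBoole U) a a b f (Ident (dzBoole U) a) = f"
    "Cmp (dzBoole U) a b b (Ident (dzBoole U) b) f = f"
    unfolding e dzBoole_def
    by (simp_all add: compose_Id[OF \<phi>] Id_compose[OF \<phi>] compose_Id[OF p] Id_compose[OF p])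
next
  fix a b c d f g k
  assume *: "f \<in> Mor (dzBoole U) a b" "g \<in> Mor (dzBoole U) b c" "k \<in> Mor (dzBoole U) c d"
  obtain A X A' X' A'' X'' A3 X3 \<phi> p \<psi> q \<chi> r
    where e: "a = (A, X)" "b = (A', X')" "c = (A'', X'')" "d = (A3, X3)"
      "f = (\<phi>, p)" "g = (\<psi>, q)" "k = (\<chi>, r)"
    by (metis surj_pair)
  have "\<phi> \<in> carrier A \<rightarrow> carrier A'" "r \<in> X3 \<rightarrow> X''"
    using * unfolding e dzBoole_def bool_hom_def by auto
  then show "Cmp (dzBoole U) a c d k (Cmp (dzBoole U) a b c g f) =
      Cmp (dzBoole U) a b d (Cmp (dzBoole U) b c d k g) f"
    unfolding e dzBoole_def by (simp add: compose_assoc)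
qed

lemma category_mzMaps: "category (mzMaps U V)"
proof
  fix a assume "a \<in> Obj (mzMaps U V)"
  then obtain A B \<alpha> where a: "a = (A, B, \<alpha>)" "boolean_alg A" "caba B" "\<alpha> \<in> bool_hom A B"
    unfolding mzMaps_def mz_map_def z_map_def by auto
  note bool_hom_funcset[OF a(4)] bool_hom_extensional[OF a(4)]
  then have "compose (carrier A) \<alpha> (\<lambda>a \<in> carrier A. a) = compose (carrier A) (\<lambda>b \<in> carrier B. b) \<alpha>"
    by (simp add: compose_Id Id_compose)
  then show "Ident (mzMaps U V) a \<in> Mor (mzMaps U V) a a"
    unfolding a(1) mzMaps_def using bool_hom_Ident[OF a(2)] complete_bool_hom_Ident[OF a(3)] by simp
next
  fix a b c f g
  assume *: "a \<in> Obj (mzMaps U V)" "b \<in> Obj (mzMaps U V)" "c \<in> Obj (mzMaps U V)"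
    "f \<in> Mor (mzMaps U V) a b" "g \<in> Mor (mzMaps U V) b c"
  obtain A B \<alpha> A' B' \<alpha>' A'' B'' \<alpha>'' \<phi> \<sigma> \<psi> \<tau>
    where e: "a = (A, B, \<alpha>)" "b = (A', B', \<alpha>')" "c = (A'', B'', \<alpha>'')" "f = (\<phi>, \<sigma>)" "g = (\<psi>, \<tau>)"
    by (metis surj_pair)
  have a: "boolean_alg A" "caba B" "\<alpha> \<in> carrier A \<rightarrow> carrier B"
    using *(1) unfolding e mzMaps_def mz_map_def z_map_def bool_hom_def by auto
  have \<alpha>': "\<alpha>' \<in> carrier A' \<rightarrow> carrier B'"
    using *(2) unfolding e mzMaps_def mz_map_def z_map_def bool_hom_def by auto
  have f: "\<phi> \<in> bool_hom A A'" "\<sigma> \<in> complete_bool_hom B B'"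
    "compose (carrier A) \<alpha>' \<phi> = compose (carrier A) \<sigma> \<alpha>"
    using *(4) unfolding e mzMaps_def by auto
  have g: "\<psi> \<in> bool_hom A' A''" "\<tau> \<in> complete_bool_hom B' B''"
    "compose (carrier A') \<alpha>'' \<psi> = compose (carrier A') \<tau> \<alpha>'"
    using *(5) unfolding e mzMaps_def by auto
  have \<phi>: "\<phi> \<in> carrier A \<rightarrow> carrier A'" using f(1) unfolding bool_hom_def by auto
  \<comment> \<open>The two commuting squares are pasted along \<alpha>'.\<close>
  have "compose (carrier A) \<alpha>'' (compose (carrier A) \<psi> \<phi>) =
      compose (carrier A) (compose (carrier A') \<tau> \<alpha>') \<phi>"
    by (simp add: compose_assoc[OF \<phi>] g(3))
  also have "\<dots> = compose (carrier A) \<tau> (compose (carrier A) \<sigma> \<alpha>)"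
    by (simp add: compose_assoc[OF \<phi>, symmetric] f(3))
  also have "\<dots> = compose (carrier A) (compose (carrier B) \<tau> \<sigma>) \<alpha>"
    by (simp add: compose_assoc[OF a(3)])
  finally show "Cmp (mzMaps U V) a b c g f \<in> Mor (mzMaps U V) a c"
    unfolding e mzMaps_def
    using bool_hom_compose[OF a(1) f(1) g(1)] complete_bool_hom_compose[OF a(2) f(2) g(2)] by simp
next
  fix a b f
  assume *: "a \<in> Obj (mzMaps U V)" "b \<in> Obj (mzMaps U V)" "f \<in> Mor (mzMaps U V) a b"
  obtain A B \<alpha> A' B' \<alpha>' \<phi> \<sigma> where e: "a = (A, B, \<alpha>)" "b = (A', B', \<alpha>')" "f = (\<phi>, \<sigma>)"
    by (metis surj_pair)
  have "\<phi> \<in> bool_hom A A'" "\<sigma> \<in> bool_hom B B'"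
    using *(3) unfolding e mzMaps_def complete_bool_hom_def by auto
  note \<phi> = bool_hom_funcset[OF this(1)] bool_hom_extensional[OF this(1)]
    and \<sigma> = bool_hom_funcset[OF this(2)] bool_hom_extensional[OF this(2)]
  show "Cmp (mzMaps U V) a a b f (Ident (mzMaps U V) a) = f"
    "Cmp (mzMaps U V) a b b (Ident (mzMaps U V) b) f = f"
    unfolding e mzMaps_def
    by (simp_all add: compose_Id[OF \<phi>] Id_compose[OF \<phi>] compose_Id[OF \<sigma>] Id_compose[OF \<sigma>])
next
  fix a b c d f g k
  assume *: "f \<in> Mor (mzMaps U V) a b" "g \<in> Mor (mzMaps U V) b c" "k \<in> Mor (mzMaps U V) c d"
  obtain A B \<alpha> A' B' \<alpha>' A'' B'' \<alpha>'' A3 B3 \<alpha>3 \<phi> \<sigma> \<psi> \<tau> \<chi> \<rho>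
    where e: "a = (A, B, \<alpha>)" "b = (A', B', \<alpha>')" "c = (A'', B'', \<alpha>'')" "d = (A3, B3, \<alpha>3)"
      "f = (\<phi>, \<sigma>)" "g = (\<psi>, \<tau>)" "k = (\<chi>, \<rho>)"
    by (metis surj_pair)
  have "\<phi> \<in> carrier A \<rightarrow> carrier A'" "\<sigma> \<in> carrier B \<rightarrow> carrier B'"
    using * unfolding e mzMaps_def bool_hom_def complete_bool_hom_def by auto
  then show "Cmp (mzMaps U V) a c d k (Cmp (mzMaps U V) a b c g f) =
      Cmp (mzMaps U V) a b d (Cmp (mzMaps U V) b c d k g) f"
    unfolding e mzMaps_def by (simp add: compose_assoc)
qed

section \<open>The functor taking an mz-map to its set of points\<close>

fun pts_obj :: "'a gorder \<times> 'b gorder \<times> ('a \<Rightarrow> 'b) \<Rightarrow> 'a gorder \<times> ('a \<Rightarrow> bool) set" where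
  "pts_obj (A, B, \<alpha>) = (A, X_of A B \<alpha>)"

text \<open>The second component is forced by the condition on morphisms of \<open>dzBoole\<close>.
  The role of \<sigma> is to ensure that its values lie in the set of points of the source.\<close>

fun pts_mor :: "'a gorder \<times> 'b gorder \<times> ('a \<Rightarrow> 'b) \<Rightarrow> 'a gorder \<times> 'b gorder \<times> ('a \<Rightarrow> 'b) \<Rightarrow>
    ('a \<Rightarrow> 'a) \<times> ('b \<Rightarrow> 'b) \<Rightarrow> ('a \<Rightarrow> 'a) \<times> (('a \<Rightarrow> bool) \<Rightarrow> ('a \<Rightarrow> bool))" where
  "pts_mor (A, B, \<alpha>) (A', B', \<alpha>') (\<phi>, \<sigma>) = (\<phi>, \<lambda>x \<in> X_of A' B' \<alpha>'. compose (carrier A) x \<phi>)"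

text \<open>A point of the target comes from an atom \<open>y\<close>, and its composite with \<phi>
  is the point of the atom dual to \<open>y\<close> under \<sigma>.\<close>

lemma pts_mor_in:
  assumes "a \<in> Obj (mzMaps U V)" "b \<in> Obj (mzMaps U V)" "f \<in> Mor (mzMaps U V) a b"
  shows "pts_mor a b f \<in> Mor (dzBoole U) (pts_obj a) (pts_obj b)"
proof -
  obtain A B \<alpha> A' B' \<alpha>' \<phi> \<sigma> where e: "a = (A, B, \<alpha>)" "b = (A', B', \<alpha>')" "f = (\<phi>, \<sigma>)"
    by (metis surj_pair)
  have B: "caba B" "\<alpha> \<in> bool_hom A B" and B': "caba B'"
    using assms unfolding e mzMaps_def mz_map_def z_map_def by auto
  have f: "\<phi> \<in> bool_hom A A'" "\<sigma> \<in> complete_bool_hom B B'"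
    "compose (carrier A) \<alpha>' \<phi> = compose (carrier A) \<sigma> \<alpha>"
    using assms(3) unfolding e mzMaps_def by auto
  have "compose (carrier A) x \<phi> \<in> X_of A B \<alpha>" if "x \<in> X_of A' B' \<alpha>'" for x
    using that complete_bool_hom_atom[OF B(1) B' f(2)] compose_atom_pt[OF f(1) B(2) f(3)]
    unfolding X_of_def by fastforce
  then show ?thesis unfolding e dzBoole_def using f(1) by auto
qed

lemma is_functor_pts: "is_functor (mzMaps U V) (dzBoole U) pts_obj pts_mor"
  unfolding is_functor_def
proof (intro conjI ballI)
  fix a assume "a \<in> Obj (mzMaps U V)"
  then obtain A B \<alpha> where a: "a = (A, B, \<alpha>)" "carrier A \<in> U" "mz_map A B \<alpha>"
    unfolding mzMaps_def by auto
  note dz = mz_map_imp_dz_algebra[OF a(3)]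
  then show "pts_obj a \<in> Obj (dzBoole U)" using a(1,2) by (simp add: dzBoole_def)
  have "x \<in> extensional (carrier A)" if "x \<in> X_of A B \<alpha>" for x
    by (rule bool_hom_extensional[of _ _ two])
      (use dz that in \<open>auto simp: dz_algebra_def z_algebra_def\<close>)
  then show "pts_mor a a (Ident (mzMaps U V) a) = Ident (dzBoole U) (pts_obj a)"
    unfolding a(1) mzMaps_def dzBoole_def
    by (auto simp: compose_def extensional_def restrict_def fun_eq_iff)
next
  fix a b c f g
  assume *: "a \<in> Obj (mzMaps U V)" "b \<in> Obj (mzMaps U V)" "c \<in> Obj (mzMaps U V)"
    "f \<in> Mor (mzMaps U V) a b" "g \<in> Mor (mzMaps U V) b c"
  obtain A B \<alpha> A' B' \<alpha>' A'' B'' \<alpha>'' \<phi> \<sigma> \<psi> \<tau>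
    where e: "a = (A, B, \<alpha>)" "b = (A', B', \<alpha>')" "c = (A'', B'', \<alpha>'')" "f = (\<phi>, \<sigma>)" "g = (\<psi>, \<tau>)"
    by (metis surj_pair)
  have \<phi>: "\<phi> \<in> carrier A \<rightarrow> carrier A'" using *(4) unfolding e mzMaps_def bool_hom_def by auto
  \<comment> \<open>The function on points attached to \<phi> is restricted to the points of
    \<alpha>', so the intermediate value has to be one of them before the two composites can be
    compared.\<close>
  have "compose (carrier A') x \<psi> \<in> X_of A' B' \<alpha>'" if "x \<in> X_of A'' B'' \<alpha>''" for x
    using pts_mor_in[OF *(2,3,5)] that unfolding e dzBoole_def by auto
  then show "pts_mor a c (Cmp (mzMaps U V) a b c g f) =
      Cmp (dzBoole U) (pts_obj a) (pts_obj b) (pts_obj c) (pts_mor b c g) (pts_mor a b f)"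
    unfolding e mzMaps_def dzBoole_def
    by (auto simp: compose_assoc[OF \<phi>] compose_def[of "X_of A'' B'' \<alpha>''"] intro!: restrict_ext)
qed (rule pts_mor_in)

text \<open>Injectivity: \<phi> fixes the point of the atom dual to each \<open>y\<close>, hence the
  atom itself by \<open>z_map_atom_pt_inj\<close>, hence \<sigma>. Surjectivity: a map of points
  lifts to a map of atoms, whose dual complete homomorphism completes the square.\<close>

lemma pts_mor_bij:
  assumes "a \<in> Obj (mzMaps U V)" "b \<in> Obj (mzMaps U V)"
  shows "bij_betw (pts_mor a b) (Mor (mzMaps U V) a b) (Mor (dzBoole U) (pts_obj a) (pts_obj b))"
proof -
  obtain A B \<alpha> A' B' \<alpha>' where e: "a = (A, B, \<alpha>)" "b = (A', B', \<alpha>')" by (metis surj_pair)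
  have a: "z_map A B \<alpha>" "caba B" "\<alpha> \<in> bool_hom A B"
    using assms(1) unfolding e mzMaps_def mz_map_def z_map_def by auto
  have b: "caba B'" "\<alpha>' \<in> bool_hom A' B'"
    using assms(2) unfolding e mzMaps_def mz_map_def z_map_def by auto
  have \<alpha>: "\<alpha> c \<in> carrier B" if "c \<in> carrier A" for c using a(3) that unfolding bool_hom_def by auto
  have \<alpha>': "\<alpha>' c \<in> carrier B'" if "c \<in> carrier A'" for c using b(2) that unfolding bool_hom_def by auto
  note atom_pt_eq = inj_onD[OF z_map_atom_pt_inj[OF a(1)]]
  show ?thesis
    unfolding bij_betw_def
  proof (intro conjI inj_onI equalityI subsetI)
    fix f g
    assume fg: "f \<in> Mor (mzMaps U V) a b" "g \<in> Mor (mzMaps U V) a b" "pts_mor a b f = pts_mor a b g"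
    obtain \<phi> \<sigma> \<tau> where f: "f = (\<phi>, \<sigma>)" and g: "g = (\<phi>, \<tau>)"
      using fg(3) unfolding e by (cases f; cases g) auto
    have \<phi>: "\<phi> \<in> bool_hom A A'"
      and \<sigma>: "\<sigma> \<in> complete_bool_hom B B'" "compose (carrier A) \<alpha>' \<phi> = compose (carrier A) \<sigma> \<alpha>"
      and \<tau>: "\<tau> \<in> complete_bool_hom B B'" "compose (carrier A) \<alpha>' \<phi> = compose (carrier A) \<tau> \<alpha>"
      using fg unfolding e f g mzMaps_def by auto
    have "\<sigma> = \<tau>"
    proof (rule complete_bool_hom_eqI[OF b(1) \<sigma>(1) \<tau>(1)])
      fix y c assume y: "y \<in> At B'" and c: "c \<in> carrier B"
      obtain x where x: "x \<in> At B" "\<forall>c \<in> carrier B. y \<sqsubseteq>\<^bsub>B'\<^esub> \<sigma> c \<longleftrightarrow> x \<sqsubseteq>\<^bsub>B\<^esub> c"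
        using complete_bool_hom_atom[OF a(2) b(1) \<sigma>(1) y] by blast
      obtain z where z: "z \<in> At B" "\<forall>c \<in> carrier B. y \<sqsubseteq>\<^bsub>B'\<^esub> \<tau> c \<longleftrightarrow> z \<sqsubseteq>\<^bsub>B\<^esub> c"
        using complete_bool_hom_atom[OF a(2) b(1) \<tau>(1) y] by blast
      \<comment> \<open>Both atoms induce the composite of the point of \<open>y\<close> with
        \<phi>.\<close>
      have "x = z"
        using compose_atom_pt[OF \<phi> a(3) \<sigma>(2) x(2)] compose_atom_pt[OF \<phi> a(3) \<tau>(2) z(2)]
          x(1) z(1) by (intro atom_pt_eq) simp_all
      then show "y \<sqsubseteq>\<^bsub>B'\<^esub> \<sigma> c \<longleftrightarrow> y \<sqsubseteq>\<^bsub>B'\<^esub> \<tau> c" using x z c by blast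
    qed
    then show "f = g" using f g by simp
  next
    fix k assume "k \<in> pts_mor a b ` Mor (mzMaps U V) a b"
    then show "k \<in> Mor (dzBoole U) (pts_obj a) (pts_obj b)" using pts_mor_in[OF assms] by blast
  next
    fix k assume k: "k \<in> Mor (dzBoole U) (pts_obj a) (pts_obj b)"
    obtain \<phi> p where kp: "k = (\<phi>, p)" by (metis surj_pair)
    have \<phi>: "\<phi> \<in> bool_hom A A'" and p: "p \<in> X_of A' B' \<alpha>' \<rightarrow>\<^sub>E X_of A B \<alpha>"
      "\<And>x. x \<in> X_of A' B' \<alpha>' \<Longrightarrow> compose (carrier A) x \<phi> = p x"
      using k unfolding e kp dzBoole_def by auto
    \<comment> \<open>The values of \<open>p\<close> are points of atoms of \<open>B\<close>;
      choosing such an atom for each \<open>y\<close> gives the map \<open>g\<close>.\<close>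
    have "\<exists>x \<in> At B. compose (carrier A) (atom_pt A' B' \<alpha>' y) \<phi> = atom_pt A B \<alpha> x"
      if y: "y \<in> At B'" for y
    proof -
      have "atom_pt A' B' \<alpha>' y \<in> X_of A' B' \<alpha>'" unfolding X_of_def using y by blast
      then have "compose (carrier A) (atom_pt A' B' \<alpha>' y) \<phi> \<in> X_of A B \<alpha>" using p by (metis PiE_mem)
      then show ?thesis unfolding X_of_def by blast
    qed
    then obtain g where g: "\<And>y. y \<in> At B' \<Longrightarrow> g y \<in> At B"
      "\<And>y. y \<in> At B' \<Longrightarrow> compose (carrier A) (atom_pt A' B' \<alpha>' y) \<phi> = atom_pt A B \<alpha> (g y)"
      by metis
    obtain \<sigma> where \<sigma>: "\<sigma> \<in> complete_bool_hom B B'"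
      "\<And>y c. \<lbrakk>y \<in> At B'; c \<in> carrier B\<rbrakk> \<Longrightarrow> y \<sqsubseteq>\<^bsub>B'\<^esub> \<sigma> c \<longleftrightarrow> g y \<sqsubseteq>\<^bsub>B\<^esub> c"
      using complete_bool_hom_of_atom_map[OF a(2) b(1), of g] g(1) by blast
    have \<sigma>_closed: "\<sigma> c \<in> carrier B'" if "c \<in> carrier B" for c
      using \<sigma>(1) that unfolding complete_bool_hom_def bool_hom_def by auto
    have \<phi>_closed: "\<phi> c \<in> carrier A'" if "c \<in> carrier A" for c
      using \<phi> that unfolding bool_hom_def by auto
    interpret B': powerset_rep B' "\<lambda>b. {x \<in> At B'. x \<sqsubseteq>\<^bsub>B'\<^esub> b}" "At B'"
      by (rule powerset_rep_caba[OF b(1)])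
    \<comment> \<open>Elements of \<open>B'\<close> are compared through the atoms below them, where
      the defining properties of \<open>g\<close> and \<sigma> meet.\<close>
    have "\<alpha>' (\<phi> c) = \<sigma> (\<alpha> c)" if c: "c \<in> carrier A" for c
    proof (rule B'.h_inj)
      have "y \<sqsubseteq>\<^bsub>B'\<^esub> \<alpha>' (\<phi> c) \<longleftrightarrow> y \<sqsubseteq>\<^bsub>B'\<^esub> \<sigma> (\<alpha> c)" if y: "y \<in> At B'" for y
        using fun_cong[OF g(2)[OF y], of c] c \<phi>_closed[OF c] \<sigma>(2)[OF y \<alpha>[OF c]]
        by (simp add: compose_def atom_pt_def)
      then show "{x \<in> At B'. x \<sqsubseteq>\<^bsub>B'\<^esub> \<alpha>' (\<phi> c)} = {x \<in> At B'. x \<sqsubseteq>\<^bsub>B'\<^esub> \<sigma> (\<alpha> c)}" by blast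
    qed (simp_all add: c \<alpha> \<alpha>' \<phi>_closed \<sigma>_closed)
    then have "compose (carrier A) \<alpha>' \<phi> = compose (carrier A) \<sigma> \<alpha>"
      by (auto simp: compose_def)
    then have "(\<phi>, \<sigma>) \<in> Mor (mzMaps U V) a b" unfolding e mzMaps_def using \<phi> \<sigma>(1) by simp
    moreover have "pts_mor a b (\<phi>, \<sigma>) = k"
      unfolding e kp using p by (auto simp: fun_eq_iff PiE_iff extensional_def)
    ultimately show "k \<in> pts_mor a b ` Mor (mzMaps U V) a b" by (metis image_eqI)
  qed
qed

text \<open>What remains is surjectivity on objects. The hypothesis on the universes provides a
  carrier in \<open>V\<close> for a copy of the power set of any set of points.\<close>

theorem theorem4p7:
  fixes U :: "'a set set" and V :: "'b set set"
  assumes "\<forall>S \<in> U. \<forall>X \<subseteq> Pow S. \<exists>T \<in> V. Pow X \<approx> T"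
  shows "equivalent_categories (mzMaps U V) (dzBoole U)"
proof (rule equivalent_categories_if_bij_on_homs[OF category_mzMaps category_dzBoole is_functor_pts pts_mor_bij])
  fix d assume "d \<in> Obj (dzBoole U)"
  then obtain A X where d: "d = (A, X)" "carrier A \<in> U" and dz: "dz_algebra A X"
    unfolding dzBoole_def by auto
  \<comment> \<open>Points are functions, whereas the hypothesis speaks of sets of subsets of the
    carrier. Each point is therefore encoded by the elements at which it is true, and extensionality
    makes the encoding injective.\<close>
  let ?S = "\<lambda>x. {a \<in> carrier A. x a}"
  have "x = y" if "x \<in> X" "y \<in> X" "?S x = ?S y" for x y
  proof (rule extensionalityI[of _ "carrier A"])
    show "x \<in> extensional (carrier A)" "y \<in> extensional (carrier A)"
      by (rule bool_hom_extensional[of _ _ two];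
          use dz that in \<open>auto simp: dz_algebra_def z_algebra_def\<close>)+
  qed (use that in blast)
  then have "bij_betw ?S X (?S ` X)" unfolding bij_betw_def inj_on_def by blast
  then have "Pow X \<approx> Pow (?S ` X)" using bij_betw_Pow unfolding eqpoll_def by blast
  moreover obtain T where "T \<in> V" "Pow (?S ` X) \<approx> T"
    using assms d(2) by (metis (no_types, lifting) PowI image_subsetI mem_Collect_eq subsetI)
  ultimately have T: "T \<in> V" "Pow X \<approx> T" using eqpoll_trans by blast+
  from ex_powerset_rep[OF T(2)] T(1) obtain B h where B: "carrier B \<in> V" and h: "powerset_rep B h X"
    by blast
  \<comment> \<open>Every set of points of \<open>X\<close> is the image under \<open>h\<close> of
    an element of \<open>B\<close>, so the map sending \<open>a\<close> to the points true at
    \<open>a\<close> can be realised with values in \<open>B\<close>.\<close>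
  have "\<forall>a. \<exists>b \<in> carrier B. h b = {x \<in> X. x a}"
    using powerset_rep.h_surj[OF h] by auto
  then obtain k where k: "\<And>a. k a \<in> carrier B" "\<And>a. h (k a) = {x \<in> X. x a}" by metis
  define \<alpha> where "\<alpha> = restrict k (carrier A)"
  have \<alpha>: "\<alpha> \<in> carrier A \<rightarrow>\<^sub>E carrier B" "\<And>a. a \<in> carrier A \<Longrightarrow> h (\<alpha> a) = {x \<in> X. x a}"
    using k by (auto simp: \<alpha>_def)
  note mz = dz_algebra_imp_mz_map[OF dz h \<alpha>]
  then have "(A, B, \<alpha>) \<in> Obj (mzMaps U V)" unfolding mzMaps_def using d(2) B by simp
  moreover have "pts_obj (A, B, \<alpha>) = d" using mz d(1) by simp
  ultimately show "\<exists>a \<in> Obj (mzMaps U V). pts_obj a = d" by blast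
qed

end
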